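(* Let $\Gamma$ be an admissible contour (lying in $D^+$ or in $D^-$) satisfying $$\mathcal{V}_0(B,\Gamma)<\tfrac14\,d^2(\Gamma),\qquad d(\Gamma):=\operatorname{dist}(\sigma_1,\Gamma).$$ Set $$r_{\min}(\Gamma)=\frac{d(\Gamma)}{2}-\sqrt{\frac{d^2(\Gamma)}{4}-\mathcal{V}_0(B,\Gamma)},\qquad r_{\max}(\Gamma)=d(\Gamma)-\sqrt{\mathcal{V}_0(B,\Gamma)}.$$ Then the equation $$X=W_1(A_1+X,\Gamma)$$ has a unique solution $X$ in any closed ball of $\mathcal{B}(\mathfrak{A}_1)$ consisting of operators $X$ with $\|X\|\le r$, where $r_{\min}(\Gamma)\le r<r_{\max}(\Gamma)$. This unique solution belongs to the smallest ball, i.e. $\|X\|\le r_{\min}(\Gamma)$.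
   Context: Let $A_0$, $A_1$ be self-adjoint operators in complex Hilbert spaces $\mathfrak{A}_0$, $\mathfrak{A}_1$, with spectra $\sigma_0$, $\sigma_1$, and let $B$ be a bounded operator from $\mathfrak{A}_1$ to $\mathfrak{A}_0$. $\mathcal{B}(\mathfrak{A}_1)$ denotes the bounded operators on $\mathfrak{A}_1$. Standing assumptions: the whole spectrum $\sigma_0$ is absolutely continuous and equals the closure of a single interval $\Delta_0=(\mu_0^{(1)},\mu_0^{(2)})$, $-\infty\le\mu_0^{(1)}<\mu_0^{(2)}\le\infty$, and $\sigma_1\subset\Delta_0$. Let $\mathsf{E}^0(\mu)=\mathsf{E}_{A_0}((-\infty,\mu))$ be the spectral function of $A_0$ and $K_B(\mu)=B^*\mathsf{E}^0(\mu)B$. It is assumed that $K_B$ is differentiable on $\Delta_0$ in operator norm and that its derivative $K_B'$ admits analytic continuation from $\Delta_0$ to a simply connected domain $D^-\subset\mathbb{C}^-$ (lower half-plane) whose boundary includes $\Delta_0$. Then $K_B'$ also continues analytically to the domain $D^+\subset\mathbb{C}^+$ symmetric to $D^-$ about the real axis, with $[K_B'(\mu)]^*=K_B'(\bar\mu)$ on $D^\pm$. If an end point $\mu_0^{(k)}$ is finite, it is assumed that $\|K_B'(\mu)\|\le C|\mu-\mu_0^{(k)}|^\gamma$ for $\mu\in D^\pm$ near $\mu_0^{(k)}$, with some $C>0$, $\gamma\in(-1,0]$. A contour $\Gamma\subset D^\pm$ is a rectifiable Jordan curve obtained by a continuous deformation of $\Delta_0$, lying in $D^+$ or in $D^-$,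 with the (finite) end points fixed, oriented from $\mu_0^{(1)}$ to $\mu_0^{(2)}$. It is called admissible if $\mathcal{V}_0(B,\Gamma):=\int_{\Gamma}|d\mu|\,\|K_B'(\mu)\|<\infty$, where $|d\mu|$ is arc length on $\Gamma$. For an operator $Z=A_1+X$, $X\in\mathcal{B}(\mathfrak{A}_1)$, whose spectrum does not intersect $\Gamma$ (and with $(Z-\mu)^{-1}$ uniformly bounded on $\Gamma$), set $$W_1(Z,\Gamma)=-\int_\Gamma d\mu\,K_B'(\mu)(Z-\mu)^{-1}\in\mathcal{B}(\mathfrak{A}_1).$$ *)

theory Defs
  imports "HOL-Analysis.Analysis"
begin

section \<open>Complex Hilbert spaces\<close>

class complex_normed_vector = real_normed_vector +
  fixes scaleC :: "complex \<Rightarrow> 'a \<Rightarrow> 'a"  (infixr \<open>*\<^sub>C\<close> 75)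
  assumes scaleR_scaleC: "r *\<^sub>R x = complex_of_real r *\<^sub>C x"
    and scaleC_add_right: "c *\<^sub>C (x + y) = c *\<^sub>C x + c *\<^sub>C y"
    and scaleC_add_left: "(c + d) *\<^sub>C x = c *\<^sub>C x + d *\<^sub>C x"
    and scaleC_scaleC: "c *\<^sub>C (d *\<^sub>C x) = (c * d) *\<^sub>C x"
    and norm_scaleC: "norm (c *\<^sub>C x) = cmod c * norm x"

class complex_hilbert = complex_normed_vector + complete_space +
  fixes cinner :: "'a \<Rightarrow> 'a \<Rightarrow> complex"
  assumes cinner_commute: "cinner x y = cnj (cinner y x)"
    and cinner_add_left: "cinner (x + y) z = cinner x z + cinner y z"
    and cinner_scaleC_left: "cinner (c *\<^sub>C x) y = c * cinner x y"
    and norm_eq_sqrt_cinner: "norm x = sqrt (Re (cinner x x))"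

instantiation complex :: complex_hilbert
begin
definition scaleC_complex :: "complex \<Rightarrow> complex \<Rightarrow> complex"
  where "scaleC_complex c z = c * z"
definition cinner_complex :: "complex \<Rightarrow> complex \<Rightarrow> complex"
  where "cinner_complex x y = x * cnj y"
instance
proof
  fix x :: complex
  show "norm x = sqrt (Re (cinner x x))"
    by (simp add: cinner_complex_def cmod_def power2_eq_square)
qed (auto simp: scaleC_complex_def cinner_complex_def algebra_simps scaleR_conv_of_real norm_mult)
end

lemma scaleC_one: "1 *\<^sub>C x = (x::'a::complex_normed_vector)"
  using scaleR_scaleC[of 1 x] by simp

lemma bounded_linear_scaleC_right:
  "bounded_linear (\<lambda>x::'a::complex_normed_vector. c *\<^sub>C x)"
proof (rule bounded_linear_intro)
  show "c *\<^sub>C (r *\<^sub>R x) = r *\<^sub>R (c *\<^sub>C x)" for r and x :: 'a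
    by (simp add: scaleR_scaleC scaleC_scaleC mult.commute)
  show "norm (c *\<^sub>C x) \<le> norm x * cmod c" for x :: 'a
    by (simp add: norm_scaleC mult.commute)
qed (rule scaleC_add_right)

instantiation blinfun :: (real_normed_vector, complex_normed_vector) complex_normed_vector
begin
lift_definition scaleC_blinfun :: "complex \<Rightarrow> 'a \<Rightarrow>\<^sub>L 'b \<Rightarrow> 'a \<Rightarrow>\<^sub>L 'b"
  is "\<lambda>c f x. c *\<^sub>C f x"
  by (rule bounded_linear_compose[OF bounded_linear_scaleC_right])
instance
proof
  fix r :: real and c d :: complex and f h :: "'a \<Rightarrow>\<^sub>L 'b"
  show "r *\<^sub>R f = complex_of_real r *\<^sub>C f"
    by transfer (simp add: scaleR_scaleC)
  show "c *\<^sub>C (f + h) = c *\<^sub>C f + c *\<^sub>C h"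
    by transfer (simp add: scaleC_add_right)
  show "(c + d) *\<^sub>C f = c *\<^sub>C f + d *\<^sub>C f"
    by transfer (simp add: scaleC_add_left)
  show "c *\<^sub>C (d *\<^sub>C f) = (c * d) *\<^sub>C f"
    by transfer (simp add: scaleC_scaleC)
  have le: "norm (c *\<^sub>C f) \<le> cmod c * norm f" for c and f :: "'a \<Rightarrow>\<^sub>L 'b"
    by (rule norm_blinfun_bound)
      (auto simp: scaleC_blinfun.rep_eq norm_scaleC mult.assoc intro!: mult_left_mono norm_blinfun)
  show "norm (c *\<^sub>C f) = cmod c * norm f"
  proof (cases "c = 0")
    case True
    then show ?thesis using le[of c f] by simp
  next
    case False
    have "f = inverse c *\<^sub>C (c *\<^sub>C f)"
      using False by (intro blinfun_eqI) (simp add: scaleC_blinfun.rep_eq scaleC_scaleC scaleC_one)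
    then have "norm f \<le> cmod (inverse c) * norm (c *\<^sub>C f)"
      using le[of "inverse c" "c *\<^sub>C f"] by simp
    then have "cmod c * norm f \<le> norm (c *\<^sub>C f)"
      using False by (simp add: norm_inverse norm_divide field_simps)
    then show ?thesis using le[of c f] by simp
  qed
qed
end

text \<open>The library type of bounded operators only asks for real linearity.\<close>

definition bounded_ops :: "('a::complex_normed_vector \<Rightarrow>\<^sub>L 'b::complex_normed_vector) set"
  where "bounded_ops = {T. \<forall>c x. blinfun_apply T (c *\<^sub>C x) = c *\<^sub>C blinfun_apply T x}"

definition hadjoint :: "('a::complex_hilbert \<Rightarrow>\<^sub>L 'b::complex_hilbert) \<Rightarrow> ('b \<Rightarrow>\<^sub>L 'a)"
  where "hadjoint T = (THE S. \<forall>x y. cinner (T x) y = cinner x (blinfun_apply S y))"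

definition complex_analytic_on ::
    "(complex \<Rightarrow> 'b::complex_normed_vector) \<Rightarrow> complex set \<Rightarrow> bool"
  where "complex_analytic_on f S \<longleftrightarrow>
    (\<forall>z\<in>S. \<exists>D. (f has_derivative (\<lambda>h. h *\<^sub>C D)) (at z))"


section \<open>Unbounded operators\<close>

text \<open>The values of \<open>act\<close> outside \<open>dom\<close> are irrelevant.\<close>

datatype 'a operator = Operator (dom: "'a set") (act: "'a \<Rightarrow> 'a")

definition linear_operator :: "'a::complex_normed_vector operator \<Rightarrow> bool"
  where "linear_operator A \<longleftrightarrow>
    0 \<in> dom A \<and>
    (\<forall>x\<in>dom A. \<forall>y\<in>dom A. x + y \<in> dom A \<and> act A (x + y) = act A x + act A y) \<and>
    (\<forall>c. \<forall>x\<in>dom A. c *\<^sub>C x \<in> dom A \<and> act A (c *\<^sub>C x) = c *\<^sub>C act A x)"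

definition op_graph :: "'a operator \<Rightarrow> ('a \<times> 'a) set"
  where "op_graph A = {(x, act A x) | x. x \<in> dom A}"

definition adjoint_graph :: "'a::complex_hilbert operator \<Rightarrow> ('a \<times> 'a) set"
  where "adjoint_graph A = {(y, z). \<forall>x\<in>dom A. cinner (act A x) y = cinner x z}"

definition self_adjoint :: "'a::complex_hilbert operator \<Rightarrow> bool"
  where "self_adjoint A \<longleftrightarrow>
    linear_operator A \<and> closure (dom A) = UNIV \<and> op_graph A = adjoint_graph A"

definition op_plus :: "'a::complex_normed_vector operator \<Rightarrow> ('a \<Rightarrow>\<^sub>L 'a) \<Rightarrow> 'a operator"
  where "op_plus A X = Operator (dom A) (\<lambda>x. act A x + X x)"

definition is_resolvent ::
    "'a::complex_normed_vector operator \<Rightarrow> complex \<Rightarrow> ('a \<Rightarrow>\<^sub>L 'a) \<Rightarrow> bool"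
  where "is_resolvent Z z R \<longleftrightarrow> R \<in> bounded_ops \<and>
    (\<forall>x. R x \<in> dom Z \<and> act Z (R x) - z *\<^sub>C R x = x) \<and>
    (\<forall>x\<in>dom Z. R (act Z x - z *\<^sub>C x) = x)"

definition spectrum :: "'a::complex_normed_vector operator \<Rightarrow> complex set"
  where "spectrum Z = {z. \<nexists>R. is_resolvent Z z R}"

definition resolvent :: "'a::complex_normed_vector operator \<Rightarrow> complex \<Rightarrow> ('a \<Rightarrow>\<^sub>L 'a)"
  where "resolvent Z z = (THE R. is_resolvent Z z R)"


section \<open>Spectral measures\<close>

definition projection_valued_measure :: "(real set \<Rightarrow> 'a::complex_hilbert \<Rightarrow>\<^sub>L 'a) \<Rightarrow> bool"
  where "projection_valued_measure E \<longleftrightarrow>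
    (\<forall>S\<in>sets borel. E S \<in> bounded_ops \<and> E S o\<^sub>L E S = E S \<and>
       (\<forall>x y. cinner (E S x) y = cinner x (E S y))) \<and>
    E UNIV = id_blinfun \<and>
    (\<forall>F :: nat \<Rightarrow> real set. range F \<subseteq> sets borel \<longrightarrow> disjoint_family F \<longrightarrow>
       (\<forall>x. (\<lambda>n. E (F n) x) sums E (\<Union>n. F n) x))"

definition scalar_measure ::
    "(real set \<Rightarrow> 'a::complex_hilbert \<Rightarrow>\<^sub>L 'a) \<Rightarrow> 'a \<Rightarrow> real measure"
  where "scalar_measure E x =
    measure_of UNIV (sets borel) (\<lambda>S. ennreal (Re (cinner (E S x) x)))"

text \<open>\<open>E\<close> is the spectral measure of \<open>A\<close>, that is, \<open>A\<close> is the integral of \<open>t\<close> against \<open>E\<close>.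
  The quadratic form determines \<open>A\<close> on its domain by polarization.\<close>

definition spectral_measure ::
    "'a::complex_hilbert operator \<Rightarrow> (real set \<Rightarrow> 'a \<Rightarrow>\<^sub>L 'a) \<Rightarrow> bool"
  where "spectral_measure A E \<longleftrightarrow> projection_valued_measure E \<and>
    dom A = {x. integrable (scalar_measure E x) (\<lambda>t. t\<^sup>2)} \<and>
    (\<forall>x\<in>dom A. cinner (act A x) x = complex_of_real (\<integral>t. t \<partial>scalar_measure E x))"

definition absolutely_continuous_spectrum ::
    "(real set \<Rightarrow> 'a::complex_hilbert \<Rightarrow>\<^sub>L 'a) \<Rightarrow> bool"
  where "absolutely_continuous_spectrum E \<longleftrightarrow>
    (\<forall>x. absolutely_continuous lborel (scalar_measure E x))"

definition K_B :: "('b::complex_hilbert \<Rightarrow>\<^sub>L 'a::complex_hilbert) \<Rightarrow>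
    (real set \<Rightarrow> 'a \<Rightarrow>\<^sub>L 'a) \<Rightarrow> real \<Rightarrow> 'b \<Rightarrow>\<^sub>L 'b"
  where "K_B B E t = hadjoint B o\<^sub>L E {..<t} o\<^sub>L B"

text \<open>\<open>K'\<close> is the derivative of \<open>K_B\<close> on the interval, together with its continuation to the
  domain \<open>D\<close> in the lower half-plane and, by reflection, to the domain symmetric to \<open>D\<close>.
  The continuation attains the derivative as its boundary value on the interval.\<close>

definition analytic_continuation_of_derivative ::
    "(real \<Rightarrow> 'b::complex_hilbert \<Rightarrow>\<^sub>L 'b) \<Rightarrow> ereal \<Rightarrow> ereal \<Rightarrow> complex set \<Rightarrow>
     (complex \<Rightarrow> 'b \<Rightarrow>\<^sub>L 'b) \<Rightarrow> bool"
  where "analytic_continuation_of_derivative K a b D K' \<longleftrightarrow>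
    (\<forall>t\<in>einterval a b. (K has_vector_derivative K' (complex_of_real t)) (at t)) \<and>
    (\<forall>z\<in>D. K' z \<in> bounded_ops) \<and>
    complex_analytic_on K' D \<and>
    continuous_on (D \<union> complex_of_real ` einterval a b) K' \<and>
    (\<forall>z\<in>D. K' (cnj z) = hadjoint (K' z))"

definition endpoint_growth ::
    "(complex \<Rightarrow> 'b::real_normed_vector) \<Rightarrow> complex set \<Rightarrow> ereal \<Rightarrow> bool"
  where "endpoint_growth K' D e \<longleftrightarrow> (\<forall>m. e = ereal m \<longrightarrow>
    (\<exists>C>0. \<exists>p. -1 < p \<and> p \<le> 0 \<and> (\<exists>\<delta>>0. \<forall>z\<in>D.
       dist z (complex_of_real m) < \<delta> \<longrightarrow> norm (K' z) \<le> C * cmod (z - complex_of_real m) powr p)))"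


section \<open>Contours and integrals along them\<close>

definition curve_length :: "(real \<Rightarrow> complex) \<Rightarrow> real set \<Rightarrow> ennreal"
  where "curve_length g S = (SUP ts \<in> {ts. sorted ts \<and> set ts \<subseteq> S}.
    ennreal (\<Sum>i<length ts - 1. dist (g (ts ! i)) (g (ts ! Suc i))))"

definition endpoint_nhds :: "ereal \<Rightarrow> complex filter"
  where "endpoint_nhds e =
    (if \<bar>e\<bar> = \<infinity> then at_infinity else nhds (complex_of_real (real_of_ereal e)))"

definition near_left_end :: "ereal \<Rightarrow> real filter"
  where "near_left_end a = filtermap real_of_ereal (at_right a)"

definition near_right_end :: "ereal \<Rightarrow> real filter"
  where "near_right_end b = filtermap real_of_ereal (at_left b)"

text \<open>A contour is parametrized by the interval from which it is deformed. The deformation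
  stays where the derivative has been continued to, that is, in \<open>D\<close> and the
  interval itself; the limits at the end points are uniform in the deformation parameter.
  The length is finite up to a finite end point, and locally finite at an infinite one.\<close>

definition contour_in :: "ereal \<Rightarrow> ereal \<Rightarrow> complex set \<Rightarrow> (real \<Rightarrow> complex) \<Rightarrow> bool"
  where "contour_in a b D g \<longleftrightarrow>
    g ` einterval a b \<subseteq> D \<and> inj_on g (einterval a b) \<and>
    (\<forall>c d. curve_length g (einterval a b \<inter> {c..d}) < \<infinity>) \<and>
    (\<exists>H. continuous_on ({0..1} \<times> einterval a b) H \<and>
       (\<forall>t\<in>einterval a b. H (0::real, t) = complex_of_real t \<and> H (1, t) = g t) \<and>
       H ` ({0..1} \<times> einterval a b) \<subseteq> D \<union> complex_of_real ` einterval a b \<and>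
       filterlim H (endpoint_nhds a) (principal {0..1} \<times>\<^sub>F near_left_end a) \<and>
       filterlim H (endpoint_nhds b) (principal {0..1} \<times>\<^sub>F near_right_end b))"

text \<open>Limits of Riemann--Stieltjes sums in which a cell \<open>k\<close> with tag \<open>t\<close> contributes \<open>s t k\<close>,
  over compact subintervals and then over the whole open interval. On continuous integrands
  the gauge limit agrees with the limit over the mesh size. Stieltjes sums are used because
  contours are merely rectifiable and integrands are operator-valued.\<close>

definition has_cell_integral ::
    "(real \<Rightarrow> real set \<Rightarrow> 'b::real_normed_vector) \<Rightarrow> 'b \<Rightarrow> ereal \<Rightarrow> ereal \<Rightarrow> bool"
  where "has_cell_integral s I a b \<longleftrightarrow>
    (\<exists>J. (\<forall>c\<in>einterval a b. \<forall>d\<in>einterval a b. c \<le> d \<longrightarrow>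
            ((\<lambda>p. \<Sum>(t, k)\<in>p. s t k) \<longlongrightarrow> J (c, d)) (division_filter {c..d})) \<and>
         (J \<longlongrightarrow> I) (near_left_end a \<times>\<^sub>F near_right_end b))"

definition has_line_integral :: "(complex \<Rightarrow> 'b::complex_normed_vector) \<Rightarrow> 'b \<Rightarrow>
    ereal \<Rightarrow> ereal \<Rightarrow> (real \<Rightarrow> complex) \<Rightarrow> bool"
  where "has_line_integral f I a b g \<longleftrightarrow>
    has_cell_integral (\<lambda>t k. (g (Sup k) - g (Inf k)) *\<^sub>C f (g t)) I a b"

definition has_arclength_integral ::
    "(complex \<Rightarrow> real) \<Rightarrow> real \<Rightarrow> ereal \<Rightarrow> ereal \<Rightarrow> (real \<Rightarrow> complex) \<Rightarrow> bool"
  where "has_arclength_integral f I a b g \<longleftrightarrow>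
    has_cell_integral (\<lambda>t k. enn2real (curve_length g k) * f (g t)) I a b"

definition admissible :: "(complex \<Rightarrow> 'b::real_normed_vector) \<Rightarrow> ereal \<Rightarrow> ereal \<Rightarrow>
    (real \<Rightarrow> complex) \<Rightarrow> bool"
  where "admissible K' a b g \<longleftrightarrow> (\<exists>v. has_arclength_integral (\<lambda>z. norm (K' z)) v a b g)"

definition V0 :: "(complex \<Rightarrow> 'b::real_normed_vector) \<Rightarrow> ereal \<Rightarrow> ereal \<Rightarrow>
    (real \<Rightarrow> complex) \<Rightarrow> real"
  where "V0 K' a b g = (THE v. has_arclength_integral (\<lambda>z. norm (K' z)) v a b g)"

definition W1_defined :: "(complex \<Rightarrow> 'b \<Rightarrow>\<^sub>L 'b) \<Rightarrow> 'b::complex_hilbert operator \<Rightarrow>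
    ereal \<Rightarrow> ereal \<Rightarrow> (real \<Rightarrow> complex) \<Rightarrow> bool"
  where "W1_defined K' Z a b g \<longleftrightarrow>
    spectrum Z \<inter> g ` einterval a b = {} \<and>
    bounded (resolvent Z ` g ` einterval a b) \<and>
    (\<exists>I. has_line_integral (\<lambda>z. K' z o\<^sub>L resolvent Z z) I a b g)"

definition W1 :: "(complex \<Rightarrow> 'b \<Rightarrow>\<^sub>L 'b) \<Rightarrow> 'b::complex_hilbert operator \<Rightarrow>
    ereal \<Rightarrow> ereal \<Rightarrow> (real \<Rightarrow> complex) \<Rightarrow> 'b \<Rightarrow>\<^sub>L 'b"
  where "W1 K' Z a b g = - (THE I. has_line_integral (\<lambda>z. K' z o\<^sub>L resolvent Z z) I a b g)"

definition solves_basic_equation :: "(complex \<Rightarrow> 'b \<Rightarrow>\<^sub>L 'b) \<Rightarrow> 'b::complex_hilbert operator \<Rightarrow>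
    ereal \<Rightarrow> ereal \<Rightarrow> (real \<Rightarrow> complex) \<Rightarrow> ('b \<Rightarrow>\<^sub>L 'b) \<Rightarrow> bool"
  where "solves_basic_equation K' A a b g X \<longleftrightarrow>
    W1_defined K' (op_plus A X) a b g \<and> X = W1 K' (op_plus A X) a b g"

text \<open>\<open>setdist\<close> is \<open>0\<close>, not \<open>\<infinity>\<close>, if the spectrum is empty, which happens only on the zero space.\<close>

definition dist_to_spectrum :: "'b::complex_hilbert operator \<Rightarrow>
    ereal \<Rightarrow> ereal \<Rightarrow> (real \<Rightarrow> complex) \<Rightarrow> real"
  where "dist_to_spectrum A a b g = setdist (spectrum A) (g ` einterval a b)"

definition r_min :: "real \<Rightarrow> real \<Rightarrow> real"
  where "r_min d v = d / 2 - sqrt (d\<^sup>2 / 4 - v)"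

definition r_max :: "real \<Rightarrow> real \<Rightarrow> real"
  where "r_max d v = d - sqrt v"

end

theory Submission
  imports Defs
begin

text \<open>
  Write \<open>R\<^sub>X(z)\<close> for the resolvent \<open>(A\<^sub>1 + X - z)\<^sup>-\<^sup>1\<close>, \<open>d\<close> for the distance between the contour and the
  spectrum of \<open>A\<^sub>1\<close>, and \<open>v\<close> for the integral of \<open>\<parallel>K'\<parallel>\<close> against arc length. The basic equation asks for
  a fixed point of \<open>F(X) = W\<^sub>1(A\<^sub>1 + X)\<close>, and the theorem is Banach's fixed point theorem for \<open>F\<close>.

  On the contour \<open>\<parallel>R\<^sub>0\<parallel> \<le> 1 / d\<close>, because \<open>A\<^sub>1\<close> is self-adjoint (\<open>self_adjoint_resolvent_bound\<close>), and so
  \<open>\<parallel>R\<^sub>X\<parallel> \<le> 1 / (d - \<parallel>X\<parallel>)\<close> for \<open>\<parallel>X\<parallel> < d\<close> (\<open>resolvent_op_plus\<close>). Integration against \<open>K'\<close> turns this into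
  \<open>\<parallel>F(X)\<parallel> \<le> v / (d - \<parallel>X\<parallel>)\<close> (\<open>norm_W1_le\<close>), and the resolvent identity
  \<open>R\<^sub>X - R\<^sub>Y = - R\<^sub>X (X - Y) R\<^sub>Y\<close> gives the Lipschitz constant \<open>v / (d - r)\<^sup>2\<close> on the ball of radius \<open>r < d\<close>
  (\<open>norm_W1_diff_le\<close>). The radius \<open>r_min\<close> is the smaller root of \<open>r (d - r) = v\<close>, so \<open>F\<close> maps that ball
  into itself, and \<open>r < r_max\<close> says that \<open>r < d\<close> and \<open>v < (d - r)\<^sup>2\<close>, so \<open>F\<close> has a
  Lipschitz constant below \<open>1\<close> on the ball of radius \<open>r\<close>. Hence there is a fixed point in the smallest ball, and a second one cannot exist in
  any of the larger balls (\<open>basic_equation_solution\<close>).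

  Three things underlie this argument. The resolvent bound is obtained without the spectral theorem:
  if \<open>T\<close> is bounded and symmetric with norm \<open>m > 0\<close>, then \<open>T\<^sup>2 - m\<^sup>2\<close> is not bounded below, hence one of
  \<open>T - m\<close>, \<open>T + m\<close> is not, and for \<open>T = (A\<^sub>1 - x)\<^sup>-\<^sup>1\<close> this produces a point of the spectrum of \<open>A\<^sub>1\<close> at
  distance \<open>1 / m\<close> from \<open>x\<close>. The operator-valued line integral exists on compact pieces since the
  integrand is continuous and the curve rectifiable (\<open>stieltjes_integral_exists\<close>), and over the
  whole contour by comparison with the arc length integral of \<open>\<parallel>K'\<parallel>\<close>
  (\<open>has_cell_integral_dominated\<close>). For a contour in the reflected domain, \<open>K'\<close> is the adjoint of its
  values on the original domain, and adjoints exist and depend continuously on the operator by the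
  Riesz representation theorem.
\<close>

section \<open>Inner products and bounded complex-linear operators\<close>

instance complex_hilbert \<subseteq> banach ..

lemma scaleC_zero_left [simp]: "0 *\<^sub>C x = (0::'a::complex_normed_vector)"
  using norm_scaleC[of 0 x] by simp

lemma scaleC_zero_right [simp]: "c *\<^sub>C 0 = (0::'a::complex_normed_vector)"
  using norm_scaleC[of c "0::'a"] by simp

lemma scaleC_diff_right: "c *\<^sub>C (x - y) = c *\<^sub>C x - c *\<^sub>C (y::'a::complex_normed_vector)"
  using bounded_linear.linear[OF bounded_linear_scaleC_right] by (rule linear_diff)

lemma scaleC_sum_left: "(\<Sum>i\<in>I. c i) *\<^sub>C x = (\<Sum>i\<in>I. c i *\<^sub>C (x::'a::complex_normed_vector))"
  by (induction I rule: infinite_finite_induct) (simp_all add: scaleC_add_left)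

lemma bounded_ops_diff: "S \<in> bounded_ops \<Longrightarrow> T \<in> bounded_ops \<Longrightarrow> S - T \<in> bounded_ops"
  by (simp add: bounded_ops_def blinfun.diff_left scaleC_diff_right)

lemma bounded_ops_scaleC: "T \<in> bounded_ops \<Longrightarrow> c *\<^sub>C T \<in> bounded_ops"
  by (simp add: bounded_ops_def scaleC_blinfun.rep_eq scaleC_scaleC mult.commute)

lemma subspace_bounded_ops:
  "subspace (bounded_ops :: ('a::complex_hilbert \<Rightarrow>\<^sub>L 'b::complex_hilbert) set)"
proof (rule subspaceI)
  show "0 \<in> (bounded_ops :: ('a \<Rightarrow>\<^sub>L 'b) set)" by (simp add: bounded_ops_def)
  show "S + T \<in> bounded_ops" if "S \<in> bounded_ops" "T \<in> bounded_ops" for S T :: "'a \<Rightarrow>\<^sub>L 'b"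
    using that by (simp add: bounded_ops_def blinfun.add_left scaleC_add_right)
  show "r *\<^sub>R T \<in> bounded_ops" if "T \<in> bounded_ops" for r and T :: "'a \<Rightarrow>\<^sub>L 'b"
    using that by (simp add: scaleR_scaleC bounded_ops_scaleC)
qed

lemma closed_bounded_ops:
  "closed (bounded_ops :: ('a::complex_hilbert \<Rightarrow>\<^sub>L 'b::complex_hilbert) set)"
proof -
  have eq: "bounded_ops = (\<Inter>c. \<Inter>x. {T :: 'a \<Rightarrow>\<^sub>L 'b. T (c *\<^sub>C x) = c *\<^sub>C T x})"
    by (auto simp: bounded_ops_def)
  show ?thesis unfolding eq
    by (intro closed_INT ballI closed_Collect_eq continuous_intros
        bounded_linear.continuous_on[OF bounded_linear_scaleC_right])
qed

lemma bounded_ops_compose: "S \<in> bounded_ops \<Longrightarrow> T \<in> bounded_ops \<Longrightarrow> S o\<^sub>L T \<in> bounded_ops"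
  by (simp add: bounded_ops_def)

lemma cinner_add_right: "cinner x (y + z) = cinner x y + cinner x (z::'a::complex_hilbert)"
  by (subst (1 2 3) cinner_commute) (simp add: cinner_add_left)

lemma cinner_scaleC_right: "cinner x (c *\<^sub>C y) = cnj c * cinner x (y::'a::complex_hilbert)"
  by (subst (1 2) cinner_commute) (simp add: cinner_scaleC_left)

lemma Re_cinner_self: "Re (cinner x x) = (norm (x::'a::complex_hilbert))\<^sup>2"
  by (metis norm_eq_sqrt_cinner norm_ge_zero real_sqrt_ge_0_iff real_sqrt_pow2)

lemma Re_cinner_commute: "Re (cinner x y) = Re (cinner y (x::'a::complex_hilbert))"
  by (metis cinner_commute cnj.sel(1))

text \<open>The real part of the inner product is a real inner product with the same norm; together with
  \<open>cinner_eqI\<close> it suffices for nearly all of the computations.\<close>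

lemma Re_cinner_scaleR_left: "Re (cinner (r *\<^sub>R x) y) = r * Re (cinner x (y::'a::complex_hilbert))"
  by (simp add: scaleR_scaleC cinner_scaleC_left)

lemma Re_cinner_scaleR_right: "Re (cinner x (r *\<^sub>R y)) = r * Re (cinner x (y::'a::complex_hilbert))"
  by (simp add: scaleR_scaleC cinner_scaleC_right)

lemma cinner_minus_left: "cinner (- x) y = - cinner x (y::'a::complex_hilbert)"
  using cinner_scaleC_left[of "-1" x y] scaleR_scaleC[of "-1" x] by simp

lemma cinner_minus_right: "cinner x (- y) = - cinner x (y::'a::complex_hilbert)"
  using cinner_scaleC_right[of x "-1" y] scaleR_scaleC[of "-1" y] by simp

lemma cinner_diff_left: "cinner (x - y) z = cinner x z - cinner y (z::'a::complex_hilbert)"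
  using cinner_add_left[of x "- y" z] by (simp add: cinner_minus_left)

lemma cinner_diff_right: "cinner x (y - z) = cinner x y - cinner x (z::'a::complex_hilbert)"
  using cinner_add_right[of x y "- z"] by (simp add: cinner_minus_right)

lemma norm_add_sq: "(norm (x + y))\<^sup>2 = (norm x)\<^sup>2 + 2 * Re (cinner x y) + (norm (y::'a::complex_hilbert))\<^sup>2"
  using Re_cinner_commute[of x y]
  by (simp add: Re_cinner_self[symmetric] cinner_add_left cinner_add_right)

lemma norm_diff_sq: "(norm (x - y))\<^sup>2 = (norm x)\<^sup>2 - 2 * Re (cinner x y) + (norm (y::'a::complex_hilbert))\<^sup>2"
  using norm_add_sq[of x "- y"] by (simp add: cinner_minus_right)

lemma Re_cinner_le: "Re (cinner x y) \<le> norm x * norm (y::'a::complex_hilbert)"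
proof -
  have "0 \<le> (norm (norm y *\<^sub>R x - norm x *\<^sub>R y))\<^sup>2" by simp
  also have "\<dots> = 2 * (norm x * norm y) * (norm x * norm y - Re (cinner x y))"
    unfolding norm_diff_sq
    by (simp add: Re_cinner_scaleR_left Re_cinner_scaleR_right algebra_simps power2_eq_square)
  finally have *: "0 \<le> 2 * (norm x * norm y) * (norm x * norm y - Re (cinner x y))" .
  show ?thesis
  proof (cases "x = 0 \<or> y = 0")
    case True
    then show ?thesis
      using Re_cinner_scaleR_left[of 0 x y] Re_cinner_scaleR_right[of x 0 y] by auto
  next
    case False
    then have "0 < 2 * (norm x * norm y)" by simp
    with * show ?thesis by (simp add: zero_le_mult_iff)
  qed
qed

lemma cinner_eq_0_all: "(\<And>x. Re (cinner x y) = 0) \<Longrightarrow> y = (0::'a::complex_hilbert)"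
  using Re_cinner_self[of y] by simp

lemma parallelogram_law:
  "(norm (x + y))\<^sup>2 + (norm (x - y))\<^sup>2 = 2 * (norm x)\<^sup>2 + 2 * (norm (y::'a::complex_hilbert))\<^sup>2"
  by (simp add: norm_add_sq norm_diff_sq)

text \<open>The representing vector minimizes \<open>Q x = \<parallel>x\<parallel>\<^sup>2 - 2 f x\<close>: by the parallelogram law any minimizing
  sequence is Cauchy, and the first variation of \<open>Q\<close> vanishes at its limit.\<close>

theorem riesz_representation_Re:
  fixes f :: "'a::complex_hilbert \<Rightarrow> real"
  assumes f: "bounded_linear f"
  shows "\<exists>y. \<forall>x. f x = Re (cinner x y)"
proof -
  interpret f: bounded_linear f by fact
  define Q where "Q x = (norm x)\<^sup>2 - 2 * f x" for x
  obtain K where K: "\<And>x. \<bar>f x\<bar> \<le> norm x * K"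
    using f.bounded by auto
  have "- K\<^sup>2 \<le> Q x" for x
    using K[of x] zero_le_power2[of "norm x - K"]
    unfolding Q_def power2_diff by (simp add: abs_le_iff)
  then have bdd: "bdd_below (range Q)" by (rule bdd_belowI2)
  define I where "I = Inf (range Q)"
  have I_le: "I \<le> Q x" for x unfolding I_def using bdd by (auto intro: cInf_lower)
  have "\<exists>x. Q x < I + inverse (real (Suc n))" for n
    using cInf_lessD[of "range Q" "I + inverse (real (Suc n))"] by (auto simp: I_def)
  then obtain X where X: "\<And>n. Q (X n) < I + inverse (real (Suc n))" by metis
  have Q_par: "(norm (x - y))\<^sup>2 \<le> 2 * (Q x - I) + 2 * (Q y - I)" for x y
  proof -
    have "I \<le> (norm (x + y))\<^sup>2 / 4 - (f x + f y)"
      using I_le[of "(1/2) *\<^sub>R (x + y)"]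
      by (simp add: Q_def f.add f.scaleR power_divide add_divide_distrib)
    then have "4 * I \<le> (norm (x + y))\<^sup>2 - 4 * f x - 4 * f y" by (simp add: field_simps)
    with parallelogram_law[of x y] show ?thesis
      unfolding Q_def right_diff_distrib by linarith
  qed
  have "Cauchy X"
  proof (rule metric_CauchyI)
    fix e :: real assume "e > 0"
    then obtain N where N: "inverse (real (Suc N)) < e\<^sup>2 / 4"
      using reals_Archimedean[of "e\<^sup>2 / 4"] by auto
    show "\<exists>M. \<forall>m\<ge>M. \<forall>n\<ge>M. dist (X m) (X n) < e"
    proof (intro exI[of _ N] allI impI)
      fix m n assume "N \<le> m" "N \<le> n"
      then have "inverse (real (Suc m)) \<le> inverse (real (Suc N))"
        "inverse (real (Suc n)) \<le> inverse (real (Suc N))" by (simp_all add: field_simps)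
      with N X[of m] X[of n] Q_par[of "X m" "X n"] have "(norm (X m - X n))\<^sup>2 < e\<^sup>2"
        unfolding right_diff_distrib by linarith
      then show "dist (X m) (X n) < e"
        using \<open>e > 0\<close> by (simp add: dist_norm power2_less_imp_less)
    qed
  qed
  then obtain y where y: "X \<longlonglongrightarrow> y" using Cauchy_convergent convergent_def by blast
  have "(\<lambda>n. Q (X n)) \<longlonglongrightarrow> Q y"
    unfolding Q_def by (intro tendsto_intros f.tendsto y)
  moreover have "(\<lambda>n. I + inverse (real (Suc n))) \<longlonglongrightarrow> I + 0"
    by (intro tendsto_intros LIMSEQ_inverse_real_of_nat)
  ultimately have "Q y \<le> I + 0"
    by (rule LIMSEQ_le) (use X in \<open>auto intro: less_imp_le\<close>)
  then have min: "Q y \<le> Q x" for x using I_le[of x] by simp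
  have "f x = Re (cinner x y)" for x
  proof -
    define a where "a = Re (cinner x y) - f x"
    \<comment> \<open>The quadratic polynomial \<open>2 t a + t\<^sup>2 (\<parallel>x\<parallel>\<^sup>2 + 1)\<close> has its minimum here; the summand \<open>1\<close> covers \<open>x = 0\<close>.\<close>
    define t where "t = - a / ((norm x)\<^sup>2 + 1)"
    have pos: "(norm x)\<^sup>2 + 1 > 0" by (simp add: add_nonneg_pos)
    have "Re (cinner y (t *\<^sub>R x)) = t * Re (cinner x y)"
      by (simp only: Re_cinner_scaleR_right Re_cinner_commute[of y x])
    then have "Q (y + t *\<^sub>R x) = Q y + 2 * t * a + t\<^sup>2 * (norm x)\<^sup>2"
      by (simp add: Q_def norm_add_sq f.add f.scaleR a_def power_mult_distrib right_diff_distrib)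
    with min[of "y + t *\<^sub>R x"] have "0 \<le> 2 * t * a + t\<^sup>2 * (norm x)\<^sup>2" by simp
    also have "\<dots> \<le> 2 * t * a + t\<^sup>2 * ((norm x)\<^sup>2 + 1)" by (simp add: algebra_simps)
    also have "\<dots> = t * (2 * a + t * ((norm x)\<^sup>2 + 1))"
      by (simp add: power2_eq_square distrib_left mult.assoc)
    also have "t * ((norm x)\<^sup>2 + 1) = - a" using pos by (simp add: t_def)
    also have "t * (2 * a + - a) = - (a\<^sup>2 / ((norm x)\<^sup>2 + 1))" by (simp add: t_def power2_eq_square)
    finally have "a\<^sup>2 \<le> 0" using pos by (simp add: divide_le_0_iff)
    then show ?thesis by (simp add: a_def)
  qed
  then show ?thesis by blast
qed

lemma cinner_eqI:
  assumes "\<And>x. Re (cinner x y) = Re (cinner x (z::'a::complex_hilbert))"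
  shows "y = z"
  using cinner_eq_0_all[of "y - z"] assms by (simp add: cinner_diff_right)

text \<open>For a complex-linear operator the imaginary parts follow on replacing \<open>x\<close> by \<open>\<i> x\<close>.\<close>

lemma cinner_apply_eq_of_Re:
  assumes T: "T \<in> bounded_ops"
    and Re: "\<And>x. Re (cinner (blinfun_apply T x) y) = Re (cinner x z)"
  shows "cinner (T x) y = cinner x z"
proof (rule complex_eqI)
  show "Re (cinner (T x) y) = Re (cinner x z)" by (rule Re)
  have "Re (cinner (T (\<i> *\<^sub>C x)) y) = Re (cinner (\<i> *\<^sub>C x) z)" by (rule Re)
  then show "Im (cinner (T x) y) = Im (cinner x z)"
    using T by (simp add: bounded_ops_def cinner_scaleC_left)
qed

lemma norm_le_of_adjoint:
  assumes "\<And>x. cinner (blinfun_apply T x) y = cinner x z"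
  shows "norm z \<le> norm T * norm y"
proof -
  have "(norm z)\<^sup>2 = Re (cinner (T z) y)" by (simp add: assms Re_cinner_self)
  also have "\<dots> \<le> norm (T z) * norm y" by (rule Re_cinner_le)
  also have "\<dots> \<le> norm T * norm z * norm y"
    by (intro mult_right_mono norm_blinfun) auto
  finally have "norm z * norm z \<le> norm z * (norm T * norm y)"
    by (simp add: power2_eq_square algebra_simps)
  then show ?thesis
    by (cases "norm z = 0") (auto simp: mult_le_cancel_left)
qed

text \<open>Riesz representation applies to \<open>x \<mapsto> Re (cinner (T x) y)\<close> for each fixed \<open>y\<close>. This fact turns the
  definite description in \<open>hadjoint\<close> into an actual adjoint.\<close>

lemma hadjoint_exists:
  fixes T :: "'a::complex_hilbert \<Rightarrow>\<^sub>L 'b::complex_hilbert"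
  assumes T: "T \<in> bounded_ops"
  shows "\<exists>S. \<forall>x y. cinner (T x) y = cinner x (blinfun_apply S y)"
proof -
  have "\<exists>z. \<forall>x. cinner (T x) y = cinner x z" for y
  proof -
    have "bounded_linear (\<lambda>x. Re (cinner (T x) y))"
    proof (rule bounded_linear_intro)
      show "norm (Re (cinner (T x) y)) \<le> norm x * (norm T * norm y)" for x
      proof -
        have "\<bar>Re (cinner (T x) y)\<bar> \<le> norm (T x) * norm y"
          using Re_cinner_le[of "T x" y] Re_cinner_le[of "- T x" y] by (simp add: cinner_minus_left)
        also have "\<dots> \<le> norm T * norm x * norm y"
          by (intro mult_right_mono norm_blinfun) auto
        finally show ?thesis by (simp add: algebra_simps)
      qed
    qed (simp_all add: blinfun.add_right blinfun.scaleR_right cinner_add_left Re_cinner_scaleR_left)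
    then obtain z where "\<forall>x. Re (cinner (T x) y) = Re (cinner x z)"
      using riesz_representation_Re by blast
    then show ?thesis using cinner_apply_eq_of_Re[OF T] by blast
  qed
  then obtain S where S: "\<And>x y. cinner (T x) y = cinner x (S y)" by metis
  have "bounded_linear S"
  proof (rule bounded_linear_intro)
    show "S (y + z) = S y + S z" for y z
      by (rule cinner_eqI) (simp add: S[symmetric] cinner_add_right)
    show "S (r *\<^sub>R y) = r *\<^sub>R S y" for r y
      by (rule cinner_eqI) (simp add: S[symmetric] Re_cinner_scaleR_right)
    show "norm (S y) \<le> norm y * norm T" for y
      using norm_le_of_adjoint[of T y "S y", OF S] by (simp add: mult.commute)
  qed
  then have "\<forall>x y. cinner (T x) y = cinner x (Blinfun S y)"
    by (simp add: S bounded_linear_Blinfun_apply)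
  then show ?thesis by blast
qed

lemma hadjoint_eqI:
  assumes "\<And>x y. cinner (blinfun_apply T x) y = cinner x (blinfun_apply S y)"
  shows "hadjoint T = S"
  unfolding hadjoint_def
proof (rule the_equality)
  show "\<forall>x y. cinner (T x) y = cinner x (S y)" using assms by blast
  fix S' assume "\<forall>x y. cinner (T x) y = cinner x (blinfun_apply S' y)"
  then show "S' = S" by (intro blinfun_eqI cinner_eqI) (metis assms)
qed

lemma cinner_hadjoint:
  assumes "T \<in> bounded_ops"
  shows "cinner (blinfun_apply T x) y = cinner x (hadjoint T y)"
  using hadjoint_exists[OF assms] hadjoint_eqI by metis

lemma hadjoint_in_bounded_ops:
  assumes "T \<in> bounded_ops"
  shows "hadjoint T \<in> bounded_ops"
proof -
  have "hadjoint T (c *\<^sub>C y) = c *\<^sub>C hadjoint T y" for c y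
    by (rule cinner_eqI) (simp only: cinner_hadjoint[OF assms, symmetric] cinner_scaleC_right)
  then show ?thesis by (simp add: bounded_ops_def)
qed

lemma hadjoint_diff:
  assumes "S \<in> bounded_ops" "T \<in> bounded_ops"
  shows "hadjoint (S - T) = hadjoint S - hadjoint T"
  by (rule hadjoint_eqI)
    (simp add: blinfun.diff_left cinner_diff_left cinner_diff_right cinner_hadjoint assms)

lemma norm_hadjoint_le:
  assumes "T \<in> bounded_ops"
  shows "norm (hadjoint T) \<le> norm T"
  by (intro norm_blinfun_bound norm_le_of_adjoint cinner_hadjoint assms norm_ge_zero)

text \<open>Taking adjoints is real-linear and does not increase norms, hence is continuous.\<close>

lemma continuous_on_hadjoint:
  fixes T :: "'c::metric_space \<Rightarrow> 'a::complex_hilbert \<Rightarrow>\<^sub>L 'b::complex_hilbert"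
  assumes cont: "continuous_on S T" and ops: "\<And>z. z \<in> S \<Longrightarrow> T z \<in> bounded_ops"
  shows "continuous_on S (\<lambda>z. hadjoint (T z))"
  unfolding continuous_on_iff
proof (intro ballI allI impI)
  fix z and e :: real assume "z \<in> S" "0 < e"
  then obtain \<delta> where "0 < \<delta>" and \<delta>: "\<And>w. w \<in> S \<Longrightarrow> dist w z < \<delta> \<Longrightarrow> dist (T w) (T z) < e"
    using cont unfolding continuous_on_iff by metis
  have "dist (hadjoint (T w)) (hadjoint (T z)) \<le> dist (T w) (T z)" if "w \<in> S" for w
    using norm_hadjoint_le[OF bounded_ops_diff[OF ops[OF that] ops[OF \<open>z \<in> S\<close>]]]
    by (simp add: dist_norm hadjoint_diff ops that \<open>z \<in> S\<close>)
  with \<open>0 < \<delta>\<close> \<delta> show "\<exists>d>0. \<forall>w\<in>S. dist w z < d \<longrightarrow> dist (hadjoint (T w)) (hadjoint (T z)) < e"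
    by (meson le_less_trans)
qed

section \<open>Resolvents of self-adjoint operators and of their bounded perturbations\<close>

lemma linear_operatorD:
  assumes "linear_operator A" "x \<in> dom A" "y \<in> dom A"
  shows "x + y \<in> dom A" "act A (x + y) = act A x + act A y"
    and "c *\<^sub>C x \<in> dom A" "act A (c *\<^sub>C x) = c *\<^sub>C act A x"
    and "x - y \<in> dom A" "act A (x - y) = act A x - act A y"
proof -
  have *: "x + y \<in> dom A" "act A (x + y) = act A x + act A y" if "y \<in> dom A" for y
    using assms(1,2) that by (auto simp: linear_operator_def)
  have scale: "c *\<^sub>C x \<in> dom A" "act A (c *\<^sub>C x) = c *\<^sub>C act A x" if "x \<in> dom A" for x c
    using assms(1) that by (auto simp: linear_operator_def)
  have minus: "- z = (- 1) *\<^sub>C z" for z :: 'a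
    using scaleR_scaleC[of "- 1" z] by simp
  have neg: "- y \<in> dom A" "act A (- y) = - act A y"
    using scale[OF assms(3), of "- 1"] by (simp_all add: minus[symmetric])
  show "x - y \<in> dom A" "act A (x - y) = act A x - act A y"
    using *[OF neg(1)] neg(2) by simp_all
  show "x + y \<in> dom A" "act A (x + y) = act A x + act A y"
    "c *\<^sub>C x \<in> dom A" "act A (c *\<^sub>C x) = c *\<^sub>C act A x"
    using *[OF assms(3)] scale[OF assms(2)] .
qed

lemma self_adjoint_cinner:
  assumes "self_adjoint A" "x \<in> dom A" "y \<in> dom A"
  shows "cinner (act A x) y = cinner x (act A y)"
proof -
  have "(y, act A y) \<in> adjoint_graph A"
    using assms by (auto simp: self_adjoint_def op_graph_def)
  with assms(2) show ?thesis by (auto simp: adjoint_graph_def)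
qed

lemma is_resolventD:
  assumes "is_resolvent Z z R"
  shows "R \<in> bounded_ops" "blinfun_apply R x \<in> dom Z" "act Z (R x) - z *\<^sub>C R x = x"
    and "u \<in> dom Z \<Longrightarrow> R (act Z u - z *\<^sub>C u) = u"
  using assms by (auto simp: is_resolvent_def)

lemma is_resolvent_unique:
  assumes "is_resolvent Z z R" "is_resolvent Z z S"
  shows "R = S"
  by (rule blinfun_eqI) (metis assms is_resolventD(2-4))

lemma resolvent_eqI: "is_resolvent Z z R \<Longrightarrow> resolvent Z z = R"
  unfolding resolvent_def by (blast intro: is_resolvent_unique)

lemma is_resolvent_resolvent: "z \<notin> spectrum Z \<Longrightarrow> is_resolvent Z z (resolvent Z z)"
  using resolvent_eqI by (auto simp: spectrum_def)

lemma norm_le_resolvent: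
  assumes "is_resolvent Z z R" "u \<in> dom Z"
  shows "norm u \<le> norm R * norm (act Z u - z *\<^sub>C u)"
  using norm_blinfun[of R "act Z u - z *\<^sub>C u"] is_resolventD(4)[OF assms] by simp

text \<open>The spectral mapping for \<open>\<lambda> \<mapsto> 1 / (\<lambda> - z)\<close>, in the direction that is used: if \<open>z + 1 / s\<close> is regular
  for \<open>A\<close>, then \<open>R - s\<close> is bounded below, because \<open>R w - s w = - s (A - (z + 1 / s)) R w\<close>.\<close>

lemma resolvent_diff_bounded_below:
  assumes A: "linear_operator A" and R: "is_resolvent A z R"
    and "s \<noteq> 0" and S: "is_resolvent A (z + 1 / s) S"
  obtains c where "c > 0" "\<And>w. c * norm w \<le> norm (R w - s *\<^sub>C w)"
proof
  define k where "k = 1 + norm S / cmod s"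
  have "k > 0" using \<open>s \<noteq> 0\<close> by (simp add: k_def add_pos_nonneg)
  then show "cmod s / k > 0" using \<open>s \<noteq> 0\<close> by simp
  fix w
  have Rw: "act A (R w) - z *\<^sub>C R w = w" "R w \<in> dom A" using is_resolventD[OF R] by auto
  \<comment> \<open>With \<open>r = (A - z - 1 / s) R w\<close> both \<open>w\<close> and \<open>R w\<close> are controlled by \<open>r\<close>.\<close>
  define r where "r = act A (R w) - (z + 1 / s) *\<^sub>C R w"
  have r: "r = w - (1 / s) *\<^sub>C R w"
    using Rw(1) by (simp add: r_def scaleC_add_left algebra_simps)
  have "R w - s *\<^sub>C w = (- s) *\<^sub>C r"
  proof -
    have "(- s) *\<^sub>C r + s *\<^sub>C r = 0"
      using scaleC_add_left[of "- s" s r] by simp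
    moreover have "s *\<^sub>C r = s *\<^sub>C w - R w"
      using \<open>s \<noteq> 0\<close> by (simp add: r scaleC_diff_right scaleC_scaleC scaleC_one)
    ultimately show ?thesis by (simp add: add_eq_0_iff2)
  qed
  then have eq: "norm (R w - s *\<^sub>C w) = cmod s * norm r" by (simp add: norm_scaleC)
  have "norm w \<le> norm r + norm ((1 / s) *\<^sub>C R w)"
    using norm_triangle_ineq[of r "(1 / s) *\<^sub>C R w"] by (simp add: r)
  also have "norm ((1 / s) *\<^sub>C R w) = norm (R w) / cmod s"
    by (simp add: norm_scaleC norm_divide)
  also have "norm (R w) \<le> norm S * norm r"
    using norm_le_resolvent[OF S Rw(2)] by (simp add: r_def)
  finally have "norm w \<le> k * norm r" using \<open>s \<noteq> 0\<close>
    by (simp add: k_def distrib_right divide_right_mono)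
  from mult_right_mono[OF this norm_ge_zero[of s]]
  show "cmod s / k * norm w \<le> norm (R w - s *\<^sub>C w)"
    using \<open>k > 0\<close> unfolding eq by (simp add: field_simps)
qed

text \<open>The claim is that \<open>m = \<parallel>R\<parallel>\<close> is at most \<open>1 / \<delta>\<close> for the resolvent \<open>R\<close> at the real point \<open>x\<close>.
  Otherwise both \<open>x + 1 / m\<close> and \<open>x - 1 / m\<close> are regular, so that \<open>R\<^sup>2 - m\<^sup>2 = (R - m) (R + m)\<close> is
  bounded below. Since \<open>R\<close> is symmetric,
  \<open>\<parallel>(R\<^sup>2 - m\<^sup>2) w\<parallel>\<^sup>2 = \<parallel>R\<^sup>2 w\<parallel>\<^sup>2 - 2 m\<^sup>2 \<parallel>R w\<parallel>\<^sup>2 + m\<^sup>4 \<parallel>w\<parallel>\<^sup>2\<close>, and such a lower bound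
  makes \<open>\<parallel>R w\<parallel>\<close> uniformly smaller than \<open>m \<parallel>w\<parallel>\<close>, which contradicts the choice of \<open>m\<close>.\<close>

lemma self_adjoint_real_lower_bound:
  fixes A :: "'a::complex_hilbert operator"
  assumes A: "self_adjoint A" and "\<delta> > 0"
    and gap: "\<And>l. complex_of_real l \<in> spectrum A \<Longrightarrow> \<delta> \<le> \<bar>l - x\<bar>"
    and u: "u \<in> dom A"
  shows "\<delta> * norm u \<le> norm (act A u - complex_of_real x *\<^sub>C u)"
proof -
  have lin: "linear_operator A" using A by (simp add: self_adjoint_def)
  have "complex_of_real x \<notin> spectrum A" using gap[of x] \<open>\<delta> > 0\<close> by auto
  then obtain R where R: "is_resolvent A (complex_of_real x) R"
    by (auto simp: spectrum_def)
  define m where "m = norm R"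
  have R_sym: "cinner (R a) b = cinner a (R b)" for a b
  proof -
    have "cinner (R a) b = cinner (R a) (act A (R b) - complex_of_real x *\<^sub>C R b)"
      by (simp add: is_resolventD(3)[OF R])
    also have "\<dots> = cinner (act A (R a) - complex_of_real x *\<^sub>C R a) (R b)"
      by (simp add: cinner_diff_left cinner_diff_right cinner_scaleC_left cinner_scaleC_right
          self_adjoint_cinner[OF A] is_resolventD(2)[OF R])
    also have "\<dots> = cinner a (R b)" by (simp add: is_resolventD(3)[OF R])
    finally show ?thesis .
  qed
  have "m * \<delta> \<le> 1"
  proof (rule ccontr)
    assume "\<not> m * \<delta> \<le> 1"
    then have "m * \<delta> > 1" by simp
    have "m > 0" using \<open>m * \<delta> > 1\<close> \<open>\<delta> > 0\<close> by (metis less_trans zero_less_mult_pos2 zero_less_one)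
    have "1 / m < \<delta>" using \<open>m * \<delta> > 1\<close> \<open>m > 0\<close> by (simp add: field_simps)
    have "\<exists>S. is_resolvent A (complex_of_real x + 1 / complex_of_real s) S" if "\<bar>s\<bar> = m" for s
    proof -
      have "\<bar>(x + 1 / s) - x\<bar> = 1 / m" using that by simp
      then have "complex_of_real (x + 1 / s) \<notin> spectrum A"
        using gap[of "x + 1 / s"] \<open>1 / m < \<delta>\<close> by auto
      then show ?thesis by (simp add: spectrum_def)
    qed
    from this[of m] this[of "- m"] \<open>m > 0\<close> obtain S S' where
      S: "is_resolvent A (complex_of_real x + 1 / complex_of_real m) S"
      and S': "is_resolvent A (complex_of_real x + 1 / complex_of_real (- m)) S'" by auto
    have m0: "complex_of_real m \<noteq> 0" "complex_of_real (- m) \<noteq> 0" using \<open>m > 0\<close> by auto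
    obtain c1 where c1: "c1 > 0" "\<And>w. c1 * norm w \<le> norm (R w - complex_of_real m *\<^sub>C w)"
      using resolvent_diff_bounded_below[OF lin R m0(1) S] by blast
    obtain c2 where c2: "c2 > 0" "\<And>w. c2 * norm w \<le> norm (R w - complex_of_real (- m) *\<^sub>C w)"
      using resolvent_diff_bounded_below[OF lin R m0(2) S'] by blast
    define c where "c = c1 * c2"
    have "c > 0" using c1 c2 by (simp add: c_def)
    have step: "(norm (R w))\<^sup>2 \<le> (m\<^sup>2 - c\<^sup>2 / m\<^sup>2) * (norm w)\<^sup>2" for w
    proof -
      define y where "y = R w + m *\<^sub>R w"
      have "c * norm w \<le> c1 * norm y"
        using c2(2)[of w, unfolded scaleR_scaleC[symmetric]] c1(1)
        by (simp add: c_def y_def mult.assoc)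
      also have "\<dots> \<le> norm (R y - m *\<^sub>R y)" by (rule c1(2)[unfolded scaleR_scaleC[symmetric]])
      also have "R y - m *\<^sub>R y = R (R w) - m\<^sup>2 *\<^sub>R w"
        by (simp add: y_def blinfun.add_right blinfun.scaleR_right algebra_simps power2_eq_square)
      finally have "(c * norm w)\<^sup>2 \<le> (norm (R (R w) - m\<^sup>2 *\<^sub>R w))\<^sup>2"
        using \<open>c > 0\<close> by (intro power_mono) auto
      also have "\<dots> = (norm (R (R w)))\<^sup>2 - 2 * m\<^sup>2 * (norm (R w))\<^sup>2 + m\<^sup>2 * m\<^sup>2 * (norm w)\<^sup>2"
      proof -
        have "Re (cinner (R (R w)) w) = (norm (R w))\<^sup>2"
          by (simp only: R_sym[of "R w" w] Re_cinner_self)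
        then show ?thesis unfolding norm_diff_sq
          by (simp add: Re_cinner_scaleR_right power_mult_distrib power2_eq_square[of "m\<^sup>2"])
      qed
      also have "norm (R (R w)) \<le> m * norm (R w)" unfolding m_def by (rule norm_blinfun)
      then have "(norm (R (R w)))\<^sup>2 \<le> m\<^sup>2 * (norm (R w))\<^sup>2"
        using power_mono[of "norm (R (R w))" "m * norm (R w)" 2] by (simp add: power_mult_distrib)
      finally have "m\<^sup>2 * (norm (R w))\<^sup>2 \<le> (m\<^sup>2 * m\<^sup>2 - c\<^sup>2) * (norm w)\<^sup>2"
        by (simp add: algebra_simps power_mult_distrib)
      then show ?thesis using \<open>m > 0\<close> by (simp add: field_simps power2_eq_square)
    qed
    \<comment> \<open>Truncation at \<open>0\<close> makes this a real root whatever the sign of the factor in \<open>step\<close>.\<close>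
    define k where "k = sqrt (max 0 (m\<^sup>2 - c\<^sup>2 / m\<^sup>2))"
    have "m \<le> k" unfolding m_def
    proof (rule norm_blinfun_bound)
      show "0 \<le> k" by (simp add: k_def)
      fix w :: 'a
      have "(m\<^sup>2 - c\<^sup>2 / m\<^sup>2) * (norm w)\<^sup>2 \<le> max 0 (m\<^sup>2 - c\<^sup>2 / m\<^sup>2) * (norm w)\<^sup>2"
        by (intro mult_right_mono) auto
      also have "\<dots> = (k * norm w)\<^sup>2" by (simp add: k_def power_mult_distrib)
      finally have "(norm (R w))\<^sup>2 \<le> (k * norm w)\<^sup>2" using step[of w] by linarith
      then show "norm (R w) \<le> k * norm w"
        by (rule power2_le_imp_le) (simp add: k_def)
    qed
    moreover have "k < sqrt (m\<^sup>2)"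
      unfolding k_def using \<open>m > 0\<close> \<open>c > 0\<close> by (intro real_sqrt_less_mono) simp
    ultimately show False using \<open>m > 0\<close> by simp
  qed
  let ?n = "norm (act A u - complex_of_real x *\<^sub>C u)"
  have "\<delta> * norm u \<le> \<delta> * (m * ?n)"
    using norm_le_resolvent[OF R u] \<open>\<delta> > 0\<close> by (simp add: m_def)
  also have "\<dots> = (m * \<delta>) * ?n" by simp
  also have "\<dots> \<le> 1 * ?n" using \<open>m * \<delta> \<le> 1\<close> by (intro mult_right_mono) auto
  finally show ?thesis by simp
qed

text \<open>For \<open>z = x + \<i> y\<close> the cross term vanishes, so \<open>\<parallel>(A - z) u\<parallel>\<^sup>2 = \<parallel>(A - x) u\<parallel>\<^sup>2 + y\<^sup>2 \<parallel>u\<parallel>\<^sup>2\<close>. For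
  real \<open>l\<close> also \<open>\<bar>l - z\<bar>\<^sup>2 = (l - x)\<^sup>2 + y\<^sup>2\<close>, which reduces the claim to the real point \<open>x\<close>.\<close>

lemma self_adjoint_lower_bound:
  fixes A :: "'a::complex_hilbert operator"
  assumes A: "self_adjoint A" and "d > 0"
    and gap: "\<And>l. l \<in> spectrum A \<Longrightarrow> d \<le> cmod (l - z)" and u: "u \<in> dom A"
  shows "d * norm u \<le> norm (act A u - z *\<^sub>C u)"
proof -
  define x y where "x = Re z" "y = Im z"
  have z: "z = complex_of_real x + \<i> * complex_of_real y" by (simp add: x_y_def complex_eq_iff)
  define p where "p = act A u - complex_of_real x *\<^sub>C u"
  have "act A u - z *\<^sub>C u = p - (\<i> * complex_of_real y) *\<^sub>C u"
    by (simp add: z p_def scaleC_add_left)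
  moreover have "Re (cinner p ((\<i> * complex_of_real y) *\<^sub>C u)) = 0"
  proof -
    have "cinner p u = cinner u p"
      by (simp add: p_def cinner_diff_left cinner_diff_right cinner_scaleC_left
          cinner_scaleC_right self_adjoint_cinner[OF A u u])
    then have "Im (cinner p u) = 0"
      using arg_cong[OF cinner_commute[of p u], of Im] by simp
    then show ?thesis by (simp add: cinner_scaleC_right)
  qed
  ultimately have pyth: "(norm (act A u - z *\<^sub>C u))\<^sup>2 = (norm p)\<^sup>2 + y\<^sup>2 * (norm u)\<^sup>2"
    by (simp add: norm_diff_sq norm_scaleC norm_mult power_mult_distrib)
  have "(d * norm u)\<^sup>2 \<le> (norm (act A u - z *\<^sub>C u))\<^sup>2"
  proof (cases "d\<^sup>2 \<le> y\<^sup>2")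
    case True
    then have "d\<^sup>2 * (norm u)\<^sup>2 \<le> y\<^sup>2 * (norm u)\<^sup>2" by (intro mult_right_mono) auto
    then show ?thesis by (simp add: pyth power_mult_distrib add_increasing)
  next
    case False
    define \<delta> where "\<delta> = sqrt (d\<^sup>2 - y\<^sup>2)"
    have \<delta>: "\<delta> > 0" "\<delta>\<^sup>2 = d\<^sup>2 - y\<^sup>2" using False by (simp_all add: \<delta>_def)
    have "\<delta> * norm u \<le> norm p" unfolding p_def
    proof (rule self_adjoint_real_lower_bound[OF A \<open>\<delta> > 0\<close> _ u])
      fix l assume "complex_of_real l \<in> spectrum A"
      then have "d\<^sup>2 \<le> (cmod (complex_of_real l - z))\<^sup>2"
        using gap \<open>d > 0\<close> by (intro power_mono) auto
      also have "\<dots> = (l - x)\<^sup>2 + y\<^sup>2" by (simp add: cmod_power2 x_y_def)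
      finally have "\<delta>\<^sup>2 \<le> \<bar>l - x\<bar>\<^sup>2" by (simp add: \<delta>(2))
      then show "\<delta> \<le> \<bar>l - x\<bar>" by (rule power2_le_imp_le) simp
    qed
    then have "(\<delta> * norm u)\<^sup>2 \<le> (norm p)\<^sup>2" using \<delta>(1) by (intro power_mono) auto
    then show ?thesis by (simp add: pyth power_mult_distrib \<delta>(2) left_diff_distrib)
  qed
  then show ?thesis by (rule power2_le_imp_le) simp
qed

theorem self_adjoint_resolvent_bound:
  fixes A :: "'a::complex_hilbert operator"
  assumes A: "self_adjoint A" and "d > 0"
    and gap: "\<And>l. l \<in> spectrum A \<Longrightarrow> d \<le> cmod (l - z)"
  shows "z \<notin> spectrum A" and "norm (resolvent A z) \<le> 1 / d"
proof -
  show z: "z \<notin> spectrum A" using gap[of z] \<open>d > 0\<close> by auto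
  note R = is_resolvent_resolvent[OF z]
  show "norm (resolvent A z) \<le> 1 / d"
  proof (rule norm_blinfun_bound)
    fix w
    have "d * norm (resolvent A z w) \<le> norm w"
      using self_adjoint_lower_bound[OF assms is_resolventD(2)[OF R, of w]]
      by (simp add: is_resolventD(3)[OF R])
    then show "norm (resolvent A z w) \<le> 1 / d * norm w" using \<open>d > 0\<close> by (simp add: field_simps)
  qed (use \<open>d > 0\<close> in simp)
qed

lemma resolvent_of_bounded_below:
  fixes Z :: "'a::complex_hilbert operator"
  assumes Z: "linear_operator Z" and "c > 0"
    and below: "\<And>u. u \<in> dom Z \<Longrightarrow> c * norm u \<le> norm (act Z u - z *\<^sub>C u)"
    and surj: "\<And>y. \<exists>u\<in>dom Z. act Z u - z *\<^sub>C u = y"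
  shows "\<exists>S. is_resolvent Z z S \<and> norm S \<le> 1 / c"
proof -
  let ?T = "\<lambda>u. act Z u - z *\<^sub>C u"
  note Zlin = linear_operatorD[OF Z]
  have inj: "u = w" if "u \<in> dom Z" "w \<in> dom Z" "?T u = ?T w" for u w
  proof -
    have diff: "?T (u - w) = ?T u - ?T w" using that(1,2) by (simp add: Zlin scaleC_diff_right)
    have "?T (u - w) = 0" unfolding diff that(3) by (rule diff_self)
    then have "c * norm (u - w) \<le> 0" using below[of "u - w"] Zlin(5)[OF that(1,2)] by simp
    then show ?thesis using \<open>c > 0\<close> by (simp add: mult_le_0_iff)
  qed
  have "\<forall>y. \<exists>u. u \<in> dom Z \<and> ?T u = y" using surj by blast
  from choice[OF this] obtain S where S: "\<And>y. S y \<in> dom Z" "\<And>y. ?T (S y) = y" by blast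
  have add: "S (x + y) = S x + S y" for x y
  proof (rule inj)
    show "S (x + y) \<in> dom Z" "S x + S y \<in> dom Z" using S(1) Zlin(1)[OF S(1) S(1)] .
    have "?T (S x + S y) = ?T (S x) + ?T (S y)"
      by (simp add: Zlin(2)[OF S(1) S(1)] scaleC_add_right)
    then show "?T (S (x + y)) = ?T (S x + S y)" by (simp only: S(2))
  qed
  have scale: "S (e *\<^sub>C x) = e *\<^sub>C S x" for e x
  proof (rule inj)
    show "S (e *\<^sub>C x) \<in> dom Z" "e *\<^sub>C S x \<in> dom Z" using S(1) Zlin(3)[OF S(1) S(1)] .
    have "?T (e *\<^sub>C S x) = e *\<^sub>C ?T (S x)"
      using Zlin(4)[OF S(1)[of x] S(1)[of x]]
      by (simp add: scaleC_diff_right scaleC_scaleC mult.commute)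
    then show "?T (S (e *\<^sub>C x)) = ?T (e *\<^sub>C S x)" by (simp only: S(2))
  qed
  have bound: "norm (S x) \<le> norm x * (1 / c)" for x
    using below[OF S(1)[of x]] \<open>c > 0\<close> by (simp add: S(2) field_simps)
  have "bounded_linear S"
    using add scale bound by (intro bounded_linear_intro[where K = "1 / c"]) (auto simp: scaleR_scaleC)
  then have apply_S: "blinfun_apply (Blinfun S) = S" by (rule bounded_linear_Blinfun_apply)
  have "is_resolvent Z z (Blinfun S)"
    unfolding is_resolvent_def bounded_ops_def using S scale inj by (simp add: apply_S)
  moreover have "norm (Blinfun S) \<le> 1 / c"
    using bound \<open>c > 0\<close> by (intro norm_blinfun_bound) (auto simp: apply_S mult.commute)
  ultimately show ?thesis by blast
qed

lemma linear_operator_op_plus: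
  assumes "linear_operator A" "X \<in> bounded_ops"
  shows "linear_operator (op_plus A X)"
  using assms
  by (auto simp: linear_operator_def op_plus_def bounded_ops_def blinfun.add_right scaleC_add_right)

text \<open>The perturbed operator is bounded below by the triangle inequality. It is onto because
  \<open>v + X R v = y\<close> is solvable: \<open>v \<mapsto> y - X R v\<close> is a contraction with constant \<open>\<parallel>X\<parallel> / d\<close>.\<close>

lemma resolvent_op_plus:
  fixes A :: "'a::complex_hilbert operator"
  assumes A: "linear_operator A" and z: "z \<notin> spectrum A" and R: "norm (resolvent A z) \<le> 1 / d"
    and X: "X \<in> bounded_ops" "norm X < d"
  shows "z \<notin> spectrum (op_plus A X)"
    and "norm (resolvent (op_plus A X) z) \<le> 1 / (d - norm X)"
proof -
  have "d > 0" using X(2) norm_ge_zero[of X] by linarith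
  let ?R = "resolvent A z"
  note res = is_resolvent_resolvent[OF z]
  have "\<exists>S. is_resolvent (op_plus A X) z S \<and> norm S \<le> 1 / (d - norm X)"
  proof (rule resolvent_of_bounded_below[OF linear_operator_op_plus[OF A X(1)]])
    show "0 < d - norm X" using X(2) by simp
    fix u assume "u \<in> dom (op_plus A X)"
    then have u: "u \<in> dom A" by (simp add: op_plus_def)
    let ?v = "act A u - z *\<^sub>C u"
    have "norm u \<le> 1 / d * norm ?v"
      using norm_le_resolvent[OF res u] mult_right_mono[OF R norm_ge_zero[of ?v]] by linarith
    then have "d * norm u \<le> norm ?v" using \<open>d > 0\<close> by (simp add: field_simps)
    moreover have "norm ?v \<le> norm (?v + X u) + norm (X u)"
      using norm_triangle_ineq4[of "?v + X u" "X u"] by simp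
    moreover have "norm (X u) \<le> norm X * norm u" by (rule norm_blinfun)
    ultimately show "(d - norm X) * norm u \<le> norm (act (op_plus A X) u - z *\<^sub>C u)"
      by (simp add: op_plus_def algebra_simps)
  next
    fix y
    let ?f = "\<lambda>v. y - X (?R v)"
    have "dist (?f v) (?f w) \<le> norm X / d * dist v w" for v w
    proof -
      have "dist (?f v) (?f w) = norm (X (?R (v - w)))"
        by (simp add: dist_norm blinfun.diff_right norm_minus_commute)
      also have "\<dots> \<le> norm X * (norm ?R * norm (v - w))"
        by (meson mult_left_mono norm_blinfun norm_ge_zero order_trans)
      also have "\<dots> \<le> norm X * (1 / d * norm (v - w))"
        using R by (intro mult_left_mono mult_right_mono) auto
      finally show ?thesis by (simp add: dist_norm)
    qed
    moreover have "0 \<le> norm X / d" "norm X / d < 1" using \<open>d > 0\<close> X(2) by simp_all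
    ultimately obtain v where "?f v = v" using banach_fix_type[of "norm X / d" ?f] by metis
    then have "act A (?R v) - z *\<^sub>C ?R v + X (?R v) = y"
      by (simp add: is_resolventD(3)[OF res] algebra_simps)
    then show "\<exists>u\<in>dom (op_plus A X). act (op_plus A X) u - z *\<^sub>C u = y"
      using is_resolventD(2)[OF res] by (intro bexI[of _ "?R v"]) (auto simp: op_plus_def algebra_simps)
  qed
  then show "z \<notin> spectrum (op_plus A X)" "norm (resolvent (op_plus A X) z) \<le> 1 / (d - norm X)"
    using resolvent_eqI by (auto simp: spectrum_def)
qed

text \<open>This is the identity \<open>R\<^sub>X - R\<^sub>Y = - R\<^sub>X (X - Y) R\<^sub>Y\<close>.\<close>

lemma norm_resolvent_op_plus_diff_le:
  fixes A :: "'a::complex_hilbert operator"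
  assumes z: "z \<notin> spectrum (op_plus A X)" "z \<notin> spectrum (op_plus A Y)"
  shows "norm (resolvent (op_plus A X) z - resolvent (op_plus A Y) z) \<le>
    norm (resolvent (op_plus A X) z) * norm (X - Y) * norm (resolvent (op_plus A Y) z)"
proof (rule norm_blinfun_bound)
  let ?R = "resolvent (op_plus A X) z" and ?S = "resolvent (op_plus A Y) z"
  note R = is_resolvent_resolvent[OF z(1)] and S = is_resolvent_resolvent[OF z(2)]
  fix u
  have "?S u \<in> dom (op_plus A X)" using is_resolventD(2)[OF S] by (simp add: op_plus_def)
  then have "?S u = ?R (act (op_plus A X) (?S u) - z *\<^sub>C ?S u)" by (simp add: is_resolventD(4)[OF R])
  also have "act (op_plus A X) (?S u) - z *\<^sub>C ?S u = u + (X - Y) (?S u)"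
    using is_resolventD(3)[OF S, of u] by (simp add: op_plus_def blinfun.diff_left algebra_simps)
  finally have "?S u = ?R u + ?R ((X - Y) (?S u))" unfolding blinfun.add_right .
  then have "(?R - ?S) u = - ?R ((X - Y) (?S u))" unfolding blinfun.diff_left[of ?R]
    by (metis add_diff_cancel_left' minus_diff_eq)
  then have "norm ((?R - ?S) u) \<le> norm ?R * norm ((X - Y) (?S u))"
    using norm_blinfun[of ?R "(X - Y) (?S u)"] by simp
  also have "\<dots> \<le> norm ?R * (norm (X - Y) * (norm ?S * norm u))"
    by (intro mult_left_mono order_trans[OF norm_blinfun] norm_blinfun) auto
  finally show "norm ((?R - ?S) u) \<le> norm ?R * norm (X - Y) * norm ?S * norm u"
    by (simp add: mult.assoc)
qed simp

text \<open>This is the identity \<open>R(z) - R(w) = (z - w) R(z) R(w)\<close>.\<close>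

lemma norm_resolvent_diff_le:
  fixes Z :: "'a::complex_hilbert operator"
  assumes z: "z \<notin> spectrum Z" "w \<notin> spectrum Z"
  shows "norm (resolvent Z z - resolvent Z w) \<le>
    norm (resolvent Z z) * cmod (z - w) * norm (resolvent Z w)"
proof (rule norm_blinfun_bound)
  let ?R = "resolvent Z z" and ?S = "resolvent Z w"
  note R = is_resolvent_resolvent[OF z(1)] and S = is_resolvent_resolvent[OF z(2)]
  fix u
  have "w *\<^sub>C ?S u = z *\<^sub>C ?S u + (w - z) *\<^sub>C ?S u"
    by (simp add: scaleC_add_left[symmetric])
  then have "act Z (?S u) - z *\<^sub>C ?S u = u + (w - z) *\<^sub>C ?S u"
    using is_resolventD(3)[OF S, of u] by (simp add: algebra_simps)
  then have "?S u = ?R (u + (w - z) *\<^sub>C ?S u)"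
    using is_resolventD(4)[OF R is_resolventD(2)[OF S, of u]] by simp
  then have "?S u = ?R u + ?R ((w - z) *\<^sub>C ?S u)" unfolding blinfun.add_right .
  then have "(?R - ?S) u = - ?R ((w - z) *\<^sub>C ?S u)" unfolding blinfun.diff_left
    by (metis add_diff_cancel_left' minus_diff_eq)
  then have "norm ((?R - ?S) u) \<le> norm ?R * (cmod (z - w) * norm (?S u))"
    using norm_blinfun[of ?R "(w - z) *\<^sub>C ?S u"] by (simp add: norm_scaleC norm_minus_commute)
  also have "\<dots> \<le> norm ?R * (cmod (z - w) * (norm ?S * norm u))"
    by (intro mult_left_mono norm_blinfun) auto
  finally show "norm ((?R - ?S) u) \<le> norm ?R * cmod (z - w) * norm ?S * norm u"
    by (simp add: mult.assoc)
qed simp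

lemma continuous_on_resolvent:
  fixes Z :: "'a::complex_hilbert operator"
  assumes S: "S \<inter> spectrum Z = {}" and M: "\<And>z. z \<in> S \<Longrightarrow> norm (resolvent Z z) \<le> M"
  shows "continuous_on S (resolvent Z)"
proof (rule lipschitz_on_continuous_on)
  show "(M * M)-lipschitz_on S (resolvent Z)"
  proof (rule lipschitz_onI)
    fix z w assume zw: "z \<in> S" "w \<in> S"
    then have "norm (resolvent Z z - resolvent Z w) \<le>
        norm (resolvent Z z) * cmod (z - w) * norm (resolvent Z w)"
      using S by (intro norm_resolvent_diff_le) auto
    also have "\<dots> \<le> M * cmod (z - w) * M"
      using M[OF zw(1)] M[OF zw(2)] order_trans[OF norm_ge_zero M[OF zw(1)]]
      by (intro mult_mono) auto
    finally show "dist (resolvent Z z) (resolvent Z w) \<le> M * M * dist z w"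
      by (simp add: dist_norm mult_ac)
  qed simp
qed

section \<open>Stieltjes integrals of continuous functions\<close>

text \<open>Increments are taken on intersections of cells, which may be empty; additivity over divisions then
  requires the value \<open>0\<close>.\<close>

definition increment :: "(real \<Rightarrow> 'a::real_normed_vector) \<Rightarrow> real set \<Rightarrow> 'a"
  where "increment g k = (if k = {} then 0 else g (Sup k) - g (Inf k))"

lemma increment_Icc: "u \<le> v \<Longrightarrow> increment g {u..v} = g v - g u"
  by (simp add: increment_def)

lemma increment_tagged_division_Int:
  fixes g :: "real \<Rightarrow> 'a::real_normed_vector"
  assumes q: "q tagged_division_of {a..b}" and k: "{u..v} \<subseteq> {a..b}"
  shows "(\<Sum>(s, l)\<in>q. increment g ({u..v} \<inter> l)) = increment g {u..v}"
proof -
  interpret operative_real plus 0 "\<lambda>l. increment g ({u..v} \<inter> l)"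
    rewrites "comm_monoid_set.F (+) 0 = sum"
  proof -
    show "operative_real plus 0 (\<lambda>l. increment g ({u..v} \<inter> l))"
    proof
      fix a b :: real
      assume "b \<le> a"
      then show "increment g ({u..v} \<inter> {a..b}) = 0"
        by (cases "max u a = min v b") (auto simp: increment_def)
    next
      fix a b c :: real
      assume "a < c" "c < b"
      consider "c < max u a" | "min v b < c" | "max u a \<le> c" "c \<le> min v b" by linarith
      then show "increment g ({u..v} \<inter> {a..c}) + increment g ({u..v} \<inter> {c..b}) =
        increment g ({u..v} \<inter> {a..b})"
        using \<open>a < c\<close> \<open>c < b\<close>
        by cases (auto simp: increment_def max_def min_def split: if_splits)
    qed
  qed (simp add: sum_def)
  have "(\<Sum>(s, l)\<in>q. increment g ({u..v} \<inter> l)) = increment g ({u..v} \<inter> {a..b})"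
    using tagged_division[of q a b] q by simp
  also have "{u..v} \<inter> {a..b} = {u..v}" using k by auto
  finally show ?thesis .
qed

lemma stieltjes_sum_refine:
  fixes g :: "real \<Rightarrow> complex" and h :: "real \<Rightarrow> 'b::complex_normed_vector"
  assumes p: "p tagged_division_of {a..b}" and q: "q tagged_division_of {a..b}"
  shows "(\<Sum>(t, k)\<in>p. (g (Sup k) - g (Inf k)) *\<^sub>C h t) =
    (\<Sum>x\<in>p. \<Sum>y\<in>q. increment g (snd x \<inter> snd y) *\<^sub>C h (fst x))"
proof (rule sum.cong[OF refl], clarify)
  fix t k assume tk: "(t, k) \<in> p"
  then obtain u v where k: "k = {u..v}"
    using tagged_division_ofD(4)[OF p tk] unfolding cbox_interval by blast
  have sub: "{u..v} \<subseteq> {a..b}" and ne: "t \<in> {u..v}"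
    using tagged_division_ofD(2,3)[OF p tk] k by auto
  have "g (Sup k) - g (Inf k) = (\<Sum>(s, l)\<in>q. increment g (k \<inter> l))"
    using increment_tagged_division_Int[OF q sub, of g] ne by (simp add: k increment_def)
  then show "(g (Sup k) - g (Inf k)) *\<^sub>C h t =
      (\<Sum>y\<in>q. increment g (snd (t, k) \<inter> snd y) *\<^sub>C h (fst (t, k)))"
    by (simp add: scaleC_sum_left case_prod_beta)
qed

text \<open>Refining two divisions by each other writes the difference of the sums as a double sum over the
  intersections \<open>k \<inter> l\<close> of \<open>increment g (k \<inter> l) (h t - h s)\<close>. There the tags are close, and the
  increments of \<open>g\<close> are dominated by those of \<open>m\<close>, which add up to \<open>m b - m a\<close>.\<close>

lemma norm_stieltjes_sum_diff_le:
  fixes g :: "real \<Rightarrow> complex" and h :: "real \<Rightarrow> 'b::complex_normed_vector"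
    and m :: "real \<Rightarrow> real"
  assumes "a \<le> b" and p: "p tagged_division_of {a..b}" and q: "q tagged_division_of {a..b}"
    and near: "\<And>t k s l. (t, k) \<in> p \<Longrightarrow> (s, l) \<in> q \<Longrightarrow> k \<inter> l \<noteq> {} \<Longrightarrow> norm (h t - h s) \<le> e"
    and dom: "\<And>x y. a \<le> x \<Longrightarrow> x \<le> y \<Longrightarrow> y \<le> b \<Longrightarrow> norm (g y - g x) \<le> m y - m x"
  shows "norm ((\<Sum>(t, k)\<in>p. (g (Sup k) - g (Inf k)) *\<^sub>C h t) -
      (\<Sum>(t, k)\<in>q. (g (Sup k) - g (Inf k)) *\<^sub>C h t)) \<le> e * (m b - m a)" (is "norm (?P - ?Q) \<le> _")
proof -
  have "?Q = (\<Sum>x\<in>p. \<Sum>y\<in>q. increment g (snd x \<inter> snd y) *\<^sub>C h (fst y))"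
    unfolding stieltjes_sum_refine[OF q p] by (subst sum.swap) (simp add: Int_commute)
  then have eq: "?P - ?Q = (\<Sum>x\<in>p. \<Sum>y\<in>q. increment g (snd x \<inter> snd y) *\<^sub>C (h (fst x) - h (fst y)))"
    by (simp add: stieltjes_sum_refine[OF p q] sum_subtractf scaleC_diff_right)
  have cell: "norm (increment g (k \<inter> l) *\<^sub>C (h t - h s)) \<le> e * increment m (k \<inter> l)"
    if tk: "(t, k) \<in> p" and sl: "(s, l) \<in> q" for t k s l
  proof (cases "k \<inter> l = {}")
    case False
    obtain u v u' v' where kl: "k = {u..v}" "l = {u'..v'}"
      using tagged_division_ofD(4)[OF p tk] tagged_division_ofD(4)[OF q sl]
      unfolding cbox_interval by blast
    define x y where "x = max u u'" "y = min v v'"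
    have int: "k \<inter> l = {x..y}" by (auto simp: kl x_y_def)
    with False have "x \<le> y" by auto
    moreover have "{x..y} \<subseteq> {a..b}"
      unfolding int[symmetric] using tagged_division_ofD(3)[OF p tk] by (rule le_infI1)
    ultimately have "norm (g y - g x) \<le> m y - m x" by (intro dom) auto
    moreover have "norm (h t - h s) \<le> e" using near[OF tk sl False] .
    ultimately have "norm (g y - g x) * norm (h t - h s) \<le> (m y - m x) * e"
      by (meson mult_mono norm_ge_zero order_trans)
    with \<open>x \<le> y\<close> show ?thesis
      by (simp add: int increment_Icc norm_scaleC mult.commute)
  qed (simp add: increment_def)
  have "norm (?P - ?Q) \<le> (\<Sum>x\<in>p. \<Sum>y\<in>q. e * increment m (snd x \<inter> snd y))"
    unfolding eq by (intro sum_norm_le) (use cell in auto)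
  also have "\<dots> = (\<Sum>x\<in>p. e * increment m (snd x))"
  proof (intro sum.cong refl)
    fix x assume "x \<in> p"
    then have "(fst x, snd x) \<in> p" by simp
    then have sub: "snd x \<subseteq> {a..b}" and "\<exists>u v. snd x = cbox u v"
      using tagged_division_ofD(3,4)[OF p] by blast+
    then obtain u v where "snd x = {u..v}" unfolding cbox_interval by blast
    with sub have "snd x = {u..v}" "{u..v} \<subseteq> {a..b}" by simp_all
    then show "(\<Sum>y\<in>q. e * increment m (snd x \<inter> snd y)) = e * increment m (snd x)"
      using increment_tagged_division_Int[OF q, of u v m]
      by (simp add: case_prod_beta sum_distrib_left[symmetric])
  qed
  also have "\<dots> = e * (\<Sum>(t, k)\<in>p. m (Sup k) - m (Inf k))"
    unfolding sum_distrib_left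
  proof (intro sum.cong refl, clarify)
    fix t k assume "(t, k) \<in> p"
    then have "k \<noteq> {}" using tagged_division_ofD(2)[OF p] by blast
    then show "e * increment m (snd (t, k)) = e * (m (Sup k) - m (Inf k))"
      by (simp add: increment_def)
  qed
  also have "\<dots> = e * (m b - m a)"
    using additive_tagged_division_1[OF \<open>a \<le> b\<close> p, of m] by simp
  finally show ?thesis .
qed

lemma cauchy_filtermap_convergent:
  fixes f :: "'a \<Rightarrow> 'b::banach"
  assumes "F \<noteq> bot"
    and "\<And>e. e > 0 \<Longrightarrow> \<exists>P. eventually P F \<and> (\<forall>x y. P x \<and> P y \<longrightarrow> dist (f x) (f y) < e)"
  shows "\<exists>l. (f \<longlongrightarrow> l) F"
proof -
  have "cauchy_filter (filtermap f F)"
    using assms(2) by (auto simp: cauchy_filter_metric_filtermap)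
  moreover have "complete (UNIV :: 'b set)"
    by (meson Cauchy_convergent UNIV_I complete_def convergent_def)
  moreover have "filtermap f F \<noteq> bot" using assms(1) by (simp add: filtermap_bot_iff)
  ultimately show ?thesis
    using complete_uniform[where S = "UNIV :: 'b set"] by (force simp: filterlim_def)
qed

lemma division_filter_Icc_not_bot [simp]: "division_filter {a..b::real} \<noteq> bot"
  using division_filter_not_empty[of a b] by simp

text \<open>The sums are Cauchy: for a gauge of balls whose radius is half a modulus of uniform continuity of
  \<open>h\<close>, the tags of two overlapping cells lie within that modulus.\<close>

lemma stieltjes_integral_exists:
  fixes g :: "real \<Rightarrow> complex" and h :: "real \<Rightarrow> 'b::{complex_normed_vector, banach}"
    and m :: "real \<Rightarrow> real"
  assumes "a \<le> b" and cont: "continuous_on {a..b} h"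
    and dom: "\<And>x y. a \<le> x \<Longrightarrow> x \<le> y \<Longrightarrow> y \<le> b \<Longrightarrow> norm (g y - g x) \<le> m y - m x"
  shows "\<exists>I. ((\<lambda>p. \<Sum>(t, k)\<in>p. (g (Sup k) - g (Inf k)) *\<^sub>C h t) \<longlongrightarrow> I) (division_filter {a..b})"
proof (rule cauchy_filtermap_convergent)
  fix e :: real assume "e > 0"
  define L where "L = m b - m a"
  have "0 \<le> L" unfolding L_def using dom[of a b] \<open>a \<le> b\<close> norm_ge_zero order_trans by blast
  define \<epsilon> where "\<epsilon> = e / (L + 1)"
  have "\<epsilon> > 0" using \<open>e > 0\<close> \<open>0 \<le> L\<close> by (simp add: \<epsilon>_def)
  have small: "\<epsilon> * L < e" using \<open>e > 0\<close> \<open>0 \<le> L\<close> by (simp add: \<epsilon>_def divide_simps mult_less_cancel_left)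
  obtain \<delta> where "\<delta> > 0" and
    \<delta>: "\<And>s t. s \<in> {a..b} \<Longrightarrow> t \<in> {a..b} \<Longrightarrow> dist t s < \<delta> \<Longrightarrow> dist (h t) (h s) < \<epsilon>"
    using compact_uniformly_continuous[OF cont compact_Icc] \<open>\<epsilon> > 0\<close>
    unfolding uniformly_continuous_on_def by blast
  define \<gamma> where "\<gamma> t = ball t (\<delta> / 2)" for t :: real
  have "gauge \<gamma>" unfolding \<gamma>_def using \<open>\<delta> > 0\<close> by (intro gauge_ball) auto
  let ?fine = "\<lambda>p. p tagged_division_of {a..b} \<and> \<gamma> fine p"
  have close: "norm (h t - h s) \<le> \<epsilon>"
    if p: "?fine p" and q: "?fine q" and tk: "(t, k) \<in> p" and sl: "(s, l) \<in> q" and "k \<inter> l \<noteq> {}"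
    for p q t k s l
  proof -
    obtain z where "z \<in> k" "z \<in> l" using \<open>k \<inter> l \<noteq> {}\<close> by auto
    then have "z \<in> \<gamma> t" "z \<in> \<gamma> s" using p q tk sl by (auto simp: fine_def)
    then have "dist t s < \<delta>"
      unfolding \<gamma>_def mem_ball using dist_triangle_half_l[of t z \<delta> s] by (simp add: dist_commute)
    moreover have "t \<in> {a..b}" "s \<in> {a..b}"
      using tagged_division_ofD(2,3)[of p "{a..b}" t k] tagged_division_ofD(2,3)[of q "{a..b}" s l]
        p q tk sl by auto
    ultimately show ?thesis using \<delta>[of s t] by (simp add: dist_norm)
  qed
  show "\<exists>P. eventually P (division_filter {a..b}) \<and> (\<forall>p q. P p \<and> P q \<longrightarrow>
    dist (\<Sum>(t, k)\<in>p. (g (Sup k) - g (Inf k)) *\<^sub>C h t)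
      (\<Sum>(t, k)\<in>q. (g (Sup k) - g (Inf k)) *\<^sub>C h t) < e)"
  proof (intro exI[of _ ?fine] conjI allI impI)
    show "eventually ?fine (division_filter {a..b})"
      using \<open>gauge \<gamma>\<close> by (auto simp: eventually_division_filter)
    fix p q assume pq: "?fine p \<and> ?fine q"
    then have "norm ((\<Sum>(t, k)\<in>p. (g (Sup k) - g (Inf k)) *\<^sub>C h t) -
        (\<Sum>(t, k)\<in>q. (g (Sup k) - g (Inf k)) *\<^sub>C h t)) \<le> \<epsilon> * (m b - m a)"
      using close[of p q] by (intro norm_stieltjes_sum_diff_le \<open>a \<le> b\<close> dom) auto
    with small show "dist (\<Sum>(t, k)\<in>p. (g (Sup k) - g (Inf k)) *\<^sub>C h t)
      (\<Sum>(t, k)\<in>q. (g (Sup k) - g (Inf k)) *\<^sub>C h t) < e"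
      by (simp add: dist_norm L_def)
  qed
qed simp

section \<open>Arc length\<close>

lemma curve_length_mono: "S \<subseteq> T \<Longrightarrow> curve_length g S \<le> curve_length g T"
  unfolding curve_length_def by (rule SUP_subset_mono) auto

lemma polygon_le_curve_length:
  "sorted ts \<Longrightarrow> set ts \<subseteq> S \<Longrightarrow>
    ennreal (\<Sum>i<length ts - 1. dist (g (ts ! i)) (g (ts ! Suc i))) \<le> curve_length g S"
  unfolding curve_length_def by (rule SUP_upper) auto

lemma dist_le_curve_length:
  assumes "u \<le> v"
  shows "ennreal (dist (g u) (g v)) \<le> curve_length g {u..v}"
  using polygon_le_curve_length[of "[u, v]" "{u..v}" g] assms by simp

lemma curve_length_singleton [simp]: "curve_length g {x} = 0"
proof -
  have "(\<Sum>i<length ts - 1. dist (g (ts ! i)) (g (ts ! Suc i))) = 0" if "set ts \<subseteq> {x}" for ts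
  proof (rule sum.neutral, safe)
    fix i assume "i < length ts - 1"
    then have "ts ! i \<in> {x}" "ts ! Suc i \<in> {x}" using that by (auto simp: subset_iff)
    then show "dist (g (ts ! i)) (g (ts ! Suc i)) = 0" by simp
  qed
  then show ?thesis unfolding curve_length_def by (auto intro!: antisym SUP_least)
qed

text \<open>Arc length from \<open>a\<close> is an increasing function that dominates the increments of \<open>g\<close>: a polygon
  inscribed up to \<open>x\<close>, followed by the chord from \<open>g x\<close> to \<open>g y\<close>, is inscribed up to \<open>y\<close>.\<close>

lemma norm_diff_le_curve_length_diff:
  assumes "a \<le> x" "x \<le> y" "y \<le> b" and fin: "curve_length g {a..b} < \<infinity>"
  shows "norm (g y - g x) \<le> enn2real (curve_length g {a..y}) - enn2real (curve_length g {a..x})"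
proof -
  define l where "l = enn2real (curve_length g {a..y})"
  have "curve_length g {a..y} < \<infinity>"
    using curve_length_mono[of "{a..y}" "{a..b}" g] assms by auto
  then have l: "curve_length g {a..y} = ennreal l" by (simp add: l_def)
  have poly: "(\<Sum>i<length ts - 1. dist (g (ts ! i)) (g (ts ! Suc i))) \<le> l - dist (g x) (g y)"
    if ts: "sorted ts" "set ts \<subseteq> {a..x}" for ts
  proof -
    let ?us = "ts @ [x, y]"
    have "sorted ?us" "set ?us \<subseteq> {a..y}"
      using ts assms by (auto simp: sorted_append subset_iff dest: order_trans)
    then have "ennreal (\<Sum>i<length ?us - 1. dist (g (?us ! i)) (g (?us ! Suc i))) \<le> ennreal l"
      using polygon_le_curve_length[of ?us "{a..y}" g] l by metis
    moreover have "0 \<le> l" by (simp add: l_def)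
    ultimately have le: "(\<Sum>i<length ?us - 1. dist (g (?us ! i)) (g (?us ! Suc i))) \<le> l"
      by (subst (asm) ennreal_le_iff)
    have "(\<Sum>i<length ts - 1. dist (g (ts ! i)) (g (ts ! Suc i))) + dist (g x) (g y)
      = (\<Sum>i\<in>insert (length ts) {..<length ts - 1}. dist (g (?us ! i)) (g (?us ! Suc i)))"
      by (auto simp: nth_append intro!: sum.cong)
    also have "\<dots> \<le> (\<Sum>i<length ?us - 1. dist (g (?us ! i)) (g (?us ! Suc i)))"
      by (rule sum_mono2) auto
    finally show ?thesis using le by simp
  qed
  have "curve_length g {a..x} \<le> ennreal (l - dist (g x) (g y))"
    unfolding curve_length_def by (rule SUP_least) (use poly in \<open>auto intro!: ennreal_leI\<close>)
  moreover have "0 \<le> l - dist (g x) (g y)" using poly[of "[]"] by simp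
  ultimately have "enn2real (curve_length g {a..x}) \<le> l - dist (g x) (g y)"
    by (metis enn2real_leI)
  then show ?thesis by (simp add: l_def dist_norm norm_minus_commute)
qed

section \<open>Improper integrals of cell functions\<close>

text \<open>The union of fine divisions of the two halves is a fine division of the whole. Both halves can
  contain the tagged cell \<open>(c, {c})\<close>, which the union counts only once; hence the condition on
  degenerate cells.\<close>

lemma cell_integral_combine:
  fixes s :: "real \<Rightarrow> real set \<Rightarrow> 'b::real_normed_vector"
  assumes "a \<le> c" "c \<le> b" and null: "\<And>t x. s t {x} = 0"
    and I: "((\<lambda>p. \<Sum>(t, k)\<in>p. s t k) \<longlongrightarrow> I) (division_filter {a..c})"
    and J: "((\<lambda>p. \<Sum>(t, k)\<in>p. s t k) \<longlongrightarrow> J) (division_filter {c..b})"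
    and K: "((\<lambda>p. \<Sum>(t, k)\<in>p. s t k) \<longlongrightarrow> K) (division_filter {a..b})"
  shows "K = I + J"
proof -
  let ?S = "\<lambda>p. \<Sum>(t, k)\<in>p. s t k"
  have "dist K (I + J) \<le> e" if "e > 0" for e
  proof -
    have "e / 3 > 0" using that by simp
    from tendstoD[OF I this] tendstoD[OF J this] tendstoD[OF K this]
    obtain g1 g2 g3 where g: "gauge g1" "gauge g2" "gauge g3"
      and 1: "\<And>p. p tagged_division_of {a..c} \<Longrightarrow> g1 fine p \<Longrightarrow> dist (?S p) I < e / 3"
      and 2: "\<And>p. p tagged_division_of {c..b} \<Longrightarrow> g2 fine p \<Longrightarrow> dist (?S p) J < e / 3"
      and 3: "\<And>p. p tagged_division_of {a..b} \<Longrightarrow> g3 fine p \<Longrightarrow> dist (?S p) K < e / 3"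
      unfolding eventually_division_filter by metis
    obtain p where "p tagged_division_of {a..c}" "(\<lambda>x. g1 x \<inter> g3 x) fine p"
      using fine_division_exists_real[OF gauge_Int[OF g(1,3)]] .
    then have p: "p tagged_division_of {a..c}" "g1 fine p" "g3 fine p" by (auto simp: fine_Int)
    obtain q where "q tagged_division_of {c..b}" "(\<lambda>x. g2 x \<inter> g3 x) fine q"
      using fine_division_exists_real[OF gauge_Int[OF g(2,3)]] .
    then have q: "q tagged_division_of {c..b}" "g2 fine q" "g3 fine q" by (auto simp: fine_Int)
    have "interior {a..c} \<inter> interior {c..b} = {}" by auto
    from tagged_division_Un[OF p(1) q(1) this]
    have "(p \<union> q) tagged_division_of {a..b}" using assms by (simp add: ivl_disj_un_two_touch(4))
    then have pq: "dist (?S (p \<union> q)) K < e / 3" using 3 p(3) q(3) fine_Un by blast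
    have "?S (p \<union> q) = ?S p + ?S q"
    proof (rule sum.union_inter_neutral)
      show "finite p" "finite q" using p q by auto
      show "\<forall>x\<in>p \<inter> q. (case x of (t, k) \<Rightarrow> s t k) = 0"
      proof safe
        fix t k assume tk: "(t, k) \<in> p" "(t, k) \<in> q"
        have "t \<in> k" "k \<subseteq> {a..c}" "k \<subseteq> {c..b}"
          using tagged_division_ofD(2,3)[OF p(1) tk(1)] tagged_division_ofD(3)[OF q(1) tk(2)] .
        moreover have "{a..c} \<inter> {c..b} \<subseteq> {c}" by auto
        ultimately have "k = {c}" by blast
        then show "s t k = 0" by (simp add: null)
      qed
    qed
    then have "dist K (I + J) \<le> dist (?S (p \<union> q)) K + dist (?S p) I + dist (?S q) J"
      using dist_triangle[of K "I + J" "?S p + ?S q"] dist_triangle_add[of "?S p" "?S q" I J]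
      by (simp add: dist_commute)
    then show ?thesis using 1[OF p(1,2)] 2[OF q(1,2)] pq by linarith
  qed
  then have "dist K (I + J) \<le> 0" by (rule field_le_epsilon[of _ 0, simplified])
  then show ?thesis by simp
qed

lemma eventually_near_left_end:
  assumes "m \<in> einterval a b"
  shows "\<forall>\<^sub>F c in near_left_end a. c \<in> einterval a b \<and> c < m"
proof -
  have "a < ereal m" and mb: "ereal m < b" using assms by (auto simp: einterval_def)
  then have "\<forall>\<^sub>F x in at_right a. a < x \<and> x < ereal m"
    by (auto simp: eventually_at_right[OF \<open>a < ereal m\<close>])
  then show ?thesis unfolding near_left_end_def eventually_filtermap
  proof eventually_elim
    case (elim x)
    then have "x = ereal (real_of_ereal x)" by (cases x) auto
    with elim mb show ?case by (auto simp: einterval_def) (metis less_ereal.simps(1) less_trans)+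
  qed
qed

lemma eventually_near_right_end:
  assumes "m \<in> einterval a b"
  shows "\<forall>\<^sub>F d in near_right_end b. d \<in> einterval a b \<and> m < d"
proof -
  have "ereal m < b" and am: "a < ereal m" using assms by (auto simp: einterval_def)
  then have "\<forall>\<^sub>F x in at_left b. ereal m < x \<and> x < b"
    by (auto simp: eventually_at_left[OF \<open>ereal m < b\<close>])
  then show ?thesis unfolding near_right_end_def eventually_filtermap
  proof eventually_elim
    case (elim x)
    then have "x = ereal (real_of_ereal x)" by (cases x) auto
    with elim am show ?case by (auto simp: einterval_def) (metis less_ereal.simps(1) less_trans)+
  qed
qed

text \<open>This makes limits at the end points, and with them improper integrals, unique.\<close>

lemma near_ends_not_bot:
  assumes "a < b"
  shows "near_left_end a \<times>\<^sub>F near_right_end b \<noteq> bot"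
proof -
  have "at_right a \<noteq> bot"
    using dense[of a] by (auto simp: trivial_limit_def eventually_at_right[OF assms])
  moreover have "at_left b \<noteq> bot"
    using dense[of _ b] by (auto simp: trivial_limit_def eventually_at_left[OF assms])
  ultimately show ?thesis
    by (simp add: prod_filter_eq_bot near_left_end_def near_right_end_def filtermap_bot_iff)
qed

lemma eventually_near_ends:
  assumes "a < b"
  shows "\<forall>\<^sub>F x in near_left_end a \<times>\<^sub>F near_right_end b.
    fst x \<in> einterval a b \<and> snd x \<in> einterval a b \<and> fst x \<le> snd x"
proof -
  obtain m where m: "m \<in> einterval a b" using einterval_nonempty[OF assms] by blast
  show ?thesis
    using eventually_prodI[OF eventually_near_left_end[OF m] eventually_near_right_end[OF m]]
    by eventually_elim auto
qed

lemma cell_integral_norm_le: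
  fixes s :: "real \<Rightarrow> real set \<Rightarrow> 'b::real_normed_vector"
  assumes bound: "\<And>t x y. t \<in> {x..y} \<Longrightarrow> {x..y} \<subseteq> {c..d} \<Longrightarrow> norm (s t {x..y}) \<le> M * w t {x..y}"
    and J: "((\<lambda>p. \<Sum>(t, k)\<in>p. s t k) \<longlongrightarrow> J) (division_filter {c..d})"
    and V: "((\<lambda>p. \<Sum>(t, k)\<in>p. w t k) \<longlongrightarrow> V) (division_filter {c..d})"
  shows "norm J \<le> M * V"
proof (rule tendsto_le[OF division_filter_Icc_not_bot[of c d]])
  show "((\<lambda>p. norm (\<Sum>(t, k)\<in>p. s t k)) \<longlongrightarrow> norm J) (division_filter {c..d})"
    using J by (rule tendsto_norm)
  show "((\<lambda>p. M * (\<Sum>(t, k)\<in>p. w t k)) \<longlongrightarrow> M * V) (division_filter {c..d})"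
    using V by (rule tendsto_mult_left)
  show "\<forall>\<^sub>F p in division_filter {c..d}. norm (\<Sum>(t, k)\<in>p. s t k) \<le> M * (\<Sum>(t, k)\<in>p. w t k)"
    using eventually_division_filter_tagged_division
  proof eventually_elim
    case (elim p)
    have "norm (\<Sum>(t, k)\<in>p. s t k) \<le> (\<Sum>(t, k)\<in>p. M * w t k)"
    proof (rule sum_norm_le, clarify)
      fix t k assume tk: "(t, k) \<in> p"
      then obtain x y where "k = {x..y}"
        using tagged_division_ofD(4)[OF elim tk] unfolding cbox_interval by blast
      then show "norm (s t k) \<le> M * w t k"
        using tagged_division_ofD(2,3)[OF elim tk] bound by blast
    qed
    then show ?case by (simp add: sum_distrib_left case_prod_beta)
  qed
qed

definition has_local_cell_integral ::
    "(real \<Rightarrow> real set \<Rightarrow> 'b::real_normed_vector) \<Rightarrow> (real \<times> real \<Rightarrow> 'b) \<Rightarrow> ereal \<Rightarrow> ereal \<Rightarrow> bool"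
  where "has_local_cell_integral s J a b \<longleftrightarrow>
    (\<forall>c\<in>einterval a b. \<forall>d\<in>einterval a b. c \<le> d \<longrightarrow>
      ((\<lambda>p. \<Sum>(t, k)\<in>p. s t k) \<longlongrightarrow> J (c, d)) (division_filter {c..d}))"

lemma has_cell_integral_iff_local:
  "has_cell_integral s I a b \<longleftrightarrow>
    (\<exists>J. has_local_cell_integral s J a b \<and> (J \<longlongrightarrow> I) (near_left_end a \<times>\<^sub>F near_right_end b))"
  unfolding has_cell_integral_def has_local_cell_integral_def ..

lemma Icc_subset_einterval: "c \<in> einterval a b \<Longrightarrow> d \<in> einterval a b \<Longrightarrow> {c..d} \<subseteq> einterval a b"
  by (auto simp: einterval_def) (meson ereal_less_eq(3) le_less_trans less_le_trans)+

lemma has_local_cell_integral_norm_le: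
  fixes s :: "real \<Rightarrow> real set \<Rightarrow> 'b::real_normed_vector"
  assumes bound: "\<And>t x y. {x..y} \<subseteq> einterval a b \<Longrightarrow> t \<in> {x..y} \<Longrightarrow>
      norm (s t {x..y}) \<le> M * w t {x..y}"
    and J: "has_local_cell_integral s J a b" and V: "has_local_cell_integral w V a b"
    and cd: "c \<in> einterval a b" "d \<in> einterval a b" "c \<le> d"
  shows "norm (J (c, d)) \<le> M * V (c, d)"
proof (rule cell_integral_norm_le)
  show "norm (s t {x..y}) \<le> M * w t {x..y}" if "t \<in> {x..y}" "{x..y} \<subseteq> {c..d}" for t x y
    using that Icc_subset_einterval[OF cd(1,2)] by (intro bound) auto
qed (use J V cd in \<open>auto simp: has_local_cell_integral_def\<close>)

lemma has_local_cell_integral_additive: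
  assumes J: "has_local_cell_integral s J a b" and null: "\<And>t x. s t {x} = 0"
    and cde: "c \<in> einterval a b" "d \<in> einterval a b" "e \<in> einterval a b" "c \<le> d" "d \<le> e"
  shows "J (c, e) = J (c, d) + J (d, e)"
proof (rule cell_integral_combine[of c d e s])
  have "c \<le> e" using cde by simp
  with J cde show "((\<lambda>p. \<Sum>(t, k)\<in>p. s t k) \<longlongrightarrow> J (c, d)) (division_filter {c..d})"
    "((\<lambda>p. \<Sum>(t, k)\<in>p. s t k) \<longlongrightarrow> J (d, e)) (division_filter {d..e})"
    "((\<lambda>p. \<Sum>(t, k)\<in>p. s t k) \<longlongrightarrow> J (c, e)) (division_filter {c..e})"
    unfolding has_local_cell_integral_def by blast+
qed (use null cde in auto)

lemma has_cell_integral_norm_le: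
  fixes s :: "real \<Rightarrow> real set \<Rightarrow> 'b::real_normed_vector"
  assumes "a < b" and s: "has_cell_integral s I a b" and w: "has_cell_integral w v a b"
    and bound: "\<And>t x y. {x..y} \<subseteq> einterval a b \<Longrightarrow> t \<in> {x..y} \<Longrightarrow>
      norm (s t {x..y}) \<le> M * w t {x..y}"
  shows "norm I \<le> M * v"
proof -
  obtain J where J: "has_local_cell_integral s J a b"
    and JI: "(J \<longlongrightarrow> I) (near_left_end a \<times>\<^sub>F near_right_end b)"
    using s unfolding has_cell_integral_iff_local by blast
  obtain V where V: "has_local_cell_integral w V a b"
    and Vv: "(V \<longlongrightarrow> v) (near_left_end a \<times>\<^sub>F near_right_end b)"
    using w unfolding has_cell_integral_iff_local by blast
  show ?thesis
  proof (rule tendsto_le[OF near_ends_not_bot[OF \<open>a < b\<close>] tendsto_mult_left[OF Vv] tendsto_norm[OF JI]])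
    show "\<forall>\<^sub>F x in near_left_end a \<times>\<^sub>F near_right_end b. norm (J x) \<le> M * V x"
      using eventually_near_ends[OF \<open>a < b\<close>]
      by eventually_elim (metis prod.collapse has_local_cell_integral_norm_le[OF bound J V])
  qed
qed

lemma has_cell_integral_diff:
  assumes "has_cell_integral s I a b" "has_cell_integral s' I' a b"
  shows "has_cell_integral (\<lambda>t k. s t k - s' t k) (I - I') a b"
proof -
  obtain J where J: "has_local_cell_integral s J a b"
    and JI: "(J \<longlongrightarrow> I) (near_left_end a \<times>\<^sub>F near_right_end b)"
    using assms(1) unfolding has_cell_integral_iff_local by blast
  obtain J' where J': "has_local_cell_integral s' J' a b"
    and JI': "(J' \<longlongrightarrow> I') (near_left_end a \<times>\<^sub>F near_right_end b)"
    using assms(2) unfolding has_cell_integral_iff_local by blast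
  have eq: "(\<lambda>p. \<Sum>(t, k)\<in>p. s t k - s' t k) = (\<lambda>p. (\<Sum>(t, k)\<in>p. s t k) - (\<Sum>(t, k)\<in>p. s' t k))"
    by (simp add: sum_subtractf case_prod_beta)
  have "has_local_cell_integral (\<lambda>t k. s t k - s' t k) (\<lambda>x. J x - J' x) a b"
    using J J' unfolding has_local_cell_integral_def eq by (auto intro!: tendsto_diff)
  moreover note tendsto_diff[OF JI JI']
  ultimately show ?thesis unfolding has_cell_integral_iff_local by blast
qed

lemma has_cell_integral_unique:
  assumes "a < b" "has_cell_integral s I a b" "has_cell_integral s I' a b"
  shows "I = I'"
proof -
  have zero: "(\<lambda>p. \<Sum>(t, k)\<in>p. 0) = (\<lambda>p :: (real \<times> real set) set. 0 :: real)"
    by (simp add: case_prod_beta)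
  have "has_cell_integral (\<lambda>t k. 0 :: real) 0 a b"
    unfolding has_cell_integral_iff_local has_local_cell_integral_def zero
    by (intro exI[of _ "\<lambda>_. 0"]) simp
  from has_cell_integral_norm_le[OF \<open>a < b\<close> has_cell_integral_diff[OF assms(2,3)] this, of 0]
  have "norm (I - I') \<le> 0 * 0" by simp
  then show ?thesis by simp
qed

text \<open>Applied to the closed subspace of complex-linear operators, this shows that operator-valued line
  integrals are complex-linear.\<close>

lemma has_cell_integral_in_closed_subspace:
  fixes s :: "real \<Rightarrow> real set \<Rightarrow> 'b::real_normed_vector"
  assumes "a < b" and s: "has_cell_integral s I a b"
    and S: "closed S" "subspace S"
    and mem: "\<And>t x y. {x..y} \<subseteq> einterval a b \<Longrightarrow> t \<in> {x..y} \<Longrightarrow> s t {x..y} \<in> S"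
  shows "I \<in> S"
proof -
  obtain J where J: "has_local_cell_integral s J a b"
    and JI: "(J \<longlongrightarrow> I) (near_left_end a \<times>\<^sub>F near_right_end b)"
    using s unfolding has_cell_integral_iff_local by blast
  have "J (c, d) \<in> S" if cd: "c \<in> einterval a b" "d \<in> einterval a b" "c \<le> d" for c d
  proof (rule Lim_in_closed_set[OF \<open>closed S\<close> _ division_filter_Icc_not_bot[of c d]])
    show "((\<lambda>p. \<Sum>(t, k)\<in>p. s t k) \<longlongrightarrow> J (c, d)) (division_filter {c..d})"
      using J cd by (simp add: has_local_cell_integral_def)
    show "\<forall>\<^sub>F p in division_filter {c..d}. (\<Sum>(t, k)\<in>p. s t k) \<in> S"
      using eventually_division_filter_tagged_division
    proof eventually_elim
      case (elim p)
      show ?case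
      proof (rule subspace_sum[OF \<open>subspace S\<close>], clarify)
        fix t k assume tk: "(t, k) \<in> p"
        then obtain x y where "k = {x..y}"
          using tagged_division_ofD(4)[OF elim tk] unfolding cbox_interval by blast
        then show "s t k \<in> S"
          using tagged_division_ofD(2,3)[OF elim tk] Icc_subset_einterval[OF cd(1,2)] mem
          by blast
      qed
    qed
  qed
  then have "\<forall>\<^sub>F x in near_left_end a \<times>\<^sub>F near_right_end b. J x \<in> S"
    using eventually_near_ends[OF \<open>a < b\<close>] by (auto elim!: eventually_mono)
  from Lim_in_closed_set[OF \<open>closed S\<close> this near_ends_not_bot[OF \<open>a < b\<close>] JI] show ?thesis .
qed

text \<open>Comparison test for improper integrals. By additivity, moving one end of the interval from \<open>c\<close> to
  \<open>c'\<close> changes the integral of \<open>s\<close> by at most \<open>M\<close> times the change of the integral of \<open>w\<close>, so the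
  integrals of \<open>s\<close> inherit the Cauchy property from those of \<open>w\<close>.\<close>

lemma has_cell_integral_dominated:
  fixes s :: "real \<Rightarrow> real set \<Rightarrow> 'b::banach" and w :: "real \<Rightarrow> real set \<Rightarrow> real"
  assumes "a < b" and w: "has_cell_integral w v a b"
    and local: "\<And>c d. c \<in> einterval a b \<Longrightarrow> d \<in> einterval a b \<Longrightarrow> c \<le> d \<Longrightarrow>
      \<exists>J. ((\<lambda>p. \<Sum>(t, k)\<in>p. s t k) \<longlongrightarrow> J) (division_filter {c..d})"
    and bound: "\<And>t x y. {x..y} \<subseteq> einterval a b \<Longrightarrow> t \<in> {x..y} \<Longrightarrow>
      norm (s t {x..y}) \<le> M * w t {x..y}"
    and null: "\<And>t x. s t {x} = 0" "\<And>t x. w t {x} = 0" and "0 \<le> M"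
  shows "\<exists>I. has_cell_integral s I a b"
proof -
  let ?F = "near_left_end a \<times>\<^sub>F near_right_end b"
  have "\<forall>c d. \<exists>J. c \<in> einterval a b \<longrightarrow> d \<in> einterval a b \<longrightarrow> c \<le> d \<longrightarrow>
      ((\<lambda>p. \<Sum>(t, k)\<in>p. s t k) \<longlongrightarrow> J) (division_filter {c..d})"
    using local by blast
  then obtain J0 where J0: "\<And>c d. c \<in> einterval a b \<Longrightarrow> d \<in> einterval a b \<Longrightarrow> c \<le> d \<Longrightarrow>
      ((\<lambda>p. \<Sum>(t, k)\<in>p. s t k) \<longlongrightarrow> J0 c d) (division_filter {c..d})"
    by metis
  define J where "J x = J0 (fst x) (snd x)" for x
  have J: "has_local_cell_integral s J a b"
    using J0 by (simp add: has_local_cell_integral_def J_def)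
  obtain V where V: "has_local_cell_integral w V a b" and Vv: "(V \<longlongrightarrow> v) ?F"
    using w unfolding has_cell_integral_iff_local by blast
  note J_add = has_local_cell_integral_additive[OF J null(1)]
    and V_add = has_local_cell_integral_additive[OF V null(2)]
  have J_le: "norm (J (c, d)) \<le> M * V (c, d)"
    if "c \<in> einterval a b" "d \<in> einterval a b" "c \<le> d" for c d
    using has_local_cell_integral_norm_le[OF bound J V that] .
  have left: "norm (J (c, e) - J (d, e)) \<le> M * \<bar>V (c, e) - V (d, e)\<bar>"
    if *: "c \<in> einterval a b" "d \<in> einterval a b" "e \<in> einterval a b" "c \<le> e" "d \<le> e" for c d e
  proof -
    have "norm (J (c, e) - J (d, e)) \<le> M * \<bar>V (c, e) - V (d, e)\<bar>"
      if *: "c \<in> einterval a b" "d \<in> einterval a b" "e \<in> einterval a b" "c \<le> d" "d \<le> e" for c d e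
      using J_le[of c d] J_add[OF *] V_add[OF *] * \<open>0 \<le> M\<close>
      by (simp add: order_trans[OF _ mult_left_mono[OF abs_ge_self]])
    from this[of c d e] this[of d c e] * show ?thesis
      by (cases "c \<le> d") (auto simp: norm_minus_commute abs_minus_commute)
  qed
  have right: "norm (J (c, d) - J (c, e)) \<le> M * \<bar>V (c, d) - V (c, e)\<bar>"
    if *: "c \<in> einterval a b" "d \<in> einterval a b" "e \<in> einterval a b" "c \<le> d" "c \<le> e" for c d e
  proof -
    have "norm (J (c, d) - J (c, e)) \<le> M * \<bar>V (c, d) - V (c, e)\<bar>"
      if *: "c \<in> einterval a b" "d \<in> einterval a b" "e \<in> einterval a b" "c \<le> d" "d \<le> e" for c d e
      using J_le[of d e] J_add[OF *] V_add[OF *] * \<open>0 \<le> M\<close>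
      by (simp add: order_trans[OF _ mult_left_mono[OF abs_ge_self]])
    from this[of c d e] this[of c e d] * show ?thesis
      by (cases "d \<le> e") (auto simp: norm_minus_commute abs_minus_commute)
  qed
  have "\<exists>I. (J \<longlongrightarrow> I) ?F"
  proof (rule cauchy_filtermap_convergent[OF near_ends_not_bot[OF \<open>a < b\<close>]])
    fix e :: real assume "e > 0"
    define \<epsilon> where "\<epsilon> = e / (4 * (M + 1))"
    have "\<epsilon> > 0" using \<open>e > 0\<close> \<open>0 \<le> M\<close> by (simp add: \<epsilon>_def)
    have small: "M * (2 * \<epsilon>) + M * (2 * \<epsilon>) < e"
    proof -
      have "e = 4 * (M + 1) * \<epsilon>" using \<open>0 \<le> M\<close> by (simp add: \<epsilon>_def)
      with \<open>\<epsilon> > 0\<close> show ?thesis by (simp add: algebra_simps)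
    qed
    obtain m where m: "m \<in> einterval a b" using einterval_nonempty[OF \<open>a < b\<close>] by blast
    obtain P Q where P: "eventually P (near_left_end a)" and Q: "eventually Q (near_right_end b)"
      and PQ: "\<And>c d. P c \<Longrightarrow> Q d \<Longrightarrow> dist (V (c, d)) v < \<epsilon>"
      using tendstoD[OF Vv \<open>\<epsilon> > 0\<close>] unfolding eventually_prod_filter by blast
    define P' where "P' c \<longleftrightarrow> P c \<and> c \<in> einterval a b \<and> c < m" for c
    define Q' where "Q' d \<longleftrightarrow> Q d \<and> d \<in> einterval a b \<and> m < d" for d
    have "eventually P' (near_left_end a)" "eventually Q' (near_right_end b)"
      using P Q eventually_near_left_end[OF m] eventually_near_right_end[OF m]
      unfolding P'_def Q'_def by (auto intro: eventually_conj)
    then have ev: "\<forall>\<^sub>F x in ?F. P' (fst x) \<and> Q' (snd x)" by (rule eventually_prodI)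
    have "dist (J (c, d)) (J (c', d')) < e" if *: "P' c" "Q' d" "P' c'" "Q' d'" for c d c' d'
    proof -
      have V: "\<bar>V (c, d) - V (c', d)\<bar> \<le> 2 * \<epsilon>" "\<bar>V (c', d) - V (c', d')\<bar> \<le> 2 * \<epsilon>"
        using * PQ[of c d] PQ[of c' d] PQ[of c' d'] by (auto simp: P'_def Q'_def dist_real_def)
      have "norm (J (c, d) - J (c', d)) \<le> M * (2 * \<epsilon>)"
        using left[of c c' d] * V(1) \<open>0 \<le> M\<close>
        by (auto simp: P'_def Q'_def intro: order_trans mult_left_mono)
      moreover have "norm (J (c', d) - J (c', d')) \<le> M * (2 * \<epsilon>)"
        using right[of c' d d'] * V(2) \<open>0 \<le> M\<close>
        by (auto simp: P'_def Q'_def intro: order_trans mult_left_mono)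
      ultimately show ?thesis
        using dist_triangle[of "J (c, d)" "J (c', d')" "J (c', d)"] small
        by (simp add: dist_norm)
    qed
    with ev show "\<exists>P. eventually P ?F \<and> (\<forall>x y. P x \<and> P y \<longrightarrow> dist (J x) (J y) < e)"
      by (intro exI[of _ "\<lambda>x. P' (fst x) \<and> Q' (snd x)"]) auto
  qed
  with J show ?thesis unfolding has_cell_integral_iff_local by blast
qed

section \<open>The fixed point argument\<close>

lemma has_arclength_integral_nonneg:
  assumes "a < b" and v: "has_arclength_integral f v a b g" and "\<And>z. 0 \<le> f z"
  shows "0 \<le> v"
proof -
  note v = v[unfolded has_arclength_integral_def]
  have "norm v \<le> 1 * v"
    by (rule has_cell_integral_norm_le[OF \<open>a < b\<close> v v]) (simp add: assms(3))
  then show ?thesis by simp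
qed

text \<open>This is all that the fixed point argument uses of the contour, of \<open>K'\<close> and of the operator. In
  particular, both half-planes are treated alike, and self-adjointness enters only through the
  resolvent bound.\<close>

locale contour_near_operator =
  fixes K' :: "complex \<Rightarrow> 'h::complex_hilbert \<Rightarrow>\<^sub>L 'h" and A :: "'h operator"
    and a b :: ereal and g :: "real \<Rightarrow> complex" and v d :: real
  assumes a_less_b: "a < b" and A: "linear_operator A"
    and ops: "t \<in> einterval a b \<Longrightarrow> K' (g t) \<in> bounded_ops"
    and cont_g: "continuous_on (einterval a b) g"
    and cont_K: "continuous_on (einterval a b) (\<lambda>t. K' (g t))"
    and rectifiable: "curve_length g (einterval a b \<inter> {x..y}) < \<infinity>"
    and v: "has_arclength_integral (\<lambda>z. norm (K' z)) v a b g"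
    and d_pos: "d > 0"
    and regular: "t \<in> einterval a b \<Longrightarrow> g t \<notin> spectrum A"
    and resolvent_le: "t \<in> einterval a b \<Longrightarrow> norm (resolvent A (g t)) \<le> 1 / d"
begin

lemma rectifiable_Icc:
  assumes "{x..y} \<subseteq> einterval a b"
  shows "curve_length g {x..y} < \<infinity>"
  using rectifiable[of x y] assms by (simp add: Int_absorb1)

text \<open>A chord is not longer than its arc, so each cell of the line integral is dominated by the matching
  cell of the arc length integral.\<close>

lemma norm_stieltjes_cell_le:
  assumes f: "\<And>t. t \<in> einterval a b \<Longrightarrow> norm (f (g t)) \<le> M * norm (K' (g t))"
    and xy: "{x..y} \<subseteq> einterval a b" and t: "t \<in> {x..y}"
  shows "norm ((g (Sup {x..y}) - g (Inf {x..y})) *\<^sub>C f (g t)) \<le>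
    M * (enn2real (curve_length g {x..y}) * norm (K' (g t)))"
proof -
  have "x \<le> y" using t by auto
  have "ennreal (dist (g x) (g y)) \<le> ennreal (enn2real (curve_length g {x..y}))"
    using dist_le_curve_length[OF \<open>x \<le> y\<close>] rectifiable_Icc[OF xy] by simp
  then have "cmod (g y - g x) \<le> enn2real (curve_length g {x..y})"
    by (simp add: dist_norm norm_minus_commute)
  moreover have "norm (f (g t)) \<le> M * norm (K' (g t))" using f xy t by blast
  ultimately have "cmod (g y - g x) * norm (f (g t)) \<le>
      enn2real (curve_length g {x..y}) * (M * norm (K' (g t)))"
    by (intro mult_mono) auto
  then show ?thesis using \<open>x \<le> y\<close> by (simp add: norm_scaleC algebra_simps)
qed

lemma has_line_integral_norm_le:
  assumes "has_line_integral f I a b g"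
    and "\<And>t. t \<in> einterval a b \<Longrightarrow> norm (f (g t)) \<le> M * norm (K' (g t))"
  shows "norm I \<le> M * v"
  using has_cell_integral_norm_le[OF a_less_b assms(1)[unfolded has_line_integral_def]
      v[unfolded has_arclength_integral_def] norm_stieltjes_cell_le[OF assms(2)]] .

lemma line_integral_exists:
  fixes f :: "complex \<Rightarrow> 'h \<Rightarrow>\<^sub>L 'h"
  assumes cont: "continuous_on (einterval a b) (\<lambda>t. f (g t))" and "0 \<le> M"
    and bound: "\<And>t. t \<in> einterval a b \<Longrightarrow> norm (f (g t)) \<le> M * norm (K' (g t))"
  shows "\<exists>I. has_line_integral f I a b g"
  unfolding has_line_integral_def
proof (rule has_cell_integral_dominated[OF a_less_b v[unfolded has_arclength_integral_def]])
  fix x y assume xy: "x \<in> einterval a b" "y \<in> einterval a b" "x \<le> y"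
  note sub = Icc_subset_einterval[OF xy(1,2)]
  show "\<exists>J. ((\<lambda>p. \<Sum>(t, k)\<in>p. (g (Sup k) - g (Inf k)) *\<^sub>C f (g t)) \<longlongrightarrow> J) (division_filter {x..y})"
  proof (rule stieltjes_integral_exists[where m = "\<lambda>t. enn2real (curve_length g {x..t})"])
    show "continuous_on {x..y} (\<lambda>t. f (g t))" using cont sub by (rule continuous_on_subset)
    show "cmod (g t - g s) \<le> enn2real (curve_length g {x..t}) - enn2real (curve_length g {x..s})"
      if "x \<le> s" "s \<le> t" "t \<le> y" for s t
      using norm_diff_le_curve_length_diff[OF that rectifiable_Icc[OF sub]] .
  qed fact
next
  show "norm ((g (Sup {x..y}) - g (Inf {x..y})) *\<^sub>C f (g t)) \<le>
      M * (enn2real (curve_length g {x..y}) * norm (K' (g t)))"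
    if "{x..y} \<subseteq> einterval a b" "t \<in> {x..y}" for t x y
    using norm_stieltjes_cell_le[OF bound that] .
qed (use \<open>0 \<le> M\<close> in simp_all)

lemma has_line_integral_unique:
  "has_line_integral f I a b g \<Longrightarrow> has_line_integral f J a b g \<Longrightarrow> I = J"
  unfolding has_line_integral_def by (rule has_cell_integral_unique[OF a_less_b])

lemma has_line_integral_diff:
  assumes "has_line_integral f I a b g" "has_line_integral h J a b g"
  shows "has_line_integral (\<lambda>z. f z - h z) (I - J) a b g"
  using has_cell_integral_diff[OF assms[unfolded has_line_integral_def]]
  unfolding has_line_integral_def by (simp add: scaleC_diff_right)

lemma v_nonneg: "0 \<le> v"
  using has_arclength_integral_nonneg[OF a_less_b v] by simp

abbreviation R :: "('h \<Rightarrow>\<^sub>L 'h) \<Rightarrow> complex \<Rightarrow> 'h \<Rightarrow>\<^sub>L 'h"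
  where "R X \<equiv> resolvent (op_plus A X)"

text \<open>The basic equation is \<open>X = F X\<close>.\<close>

abbreviation F :: "('h \<Rightarrow>\<^sub>L 'h) \<Rightarrow> 'h \<Rightarrow>\<^sub>L 'h"
  where "F X \<equiv> W1 K' (op_plus A X) a b g"

context
  fixes X :: "'h \<Rightarrow>\<^sub>L 'h"
  assumes X: "X \<in> bounded_ops" "norm X < d"
begin

lemma regular_op_plus: "t \<in> einterval a b \<Longrightarrow> g t \<notin> spectrum (op_plus A X)"
  and resolvent_op_plus_le: "t \<in> einterval a b \<Longrightarrow> norm (R X (g t)) \<le> 1 / (d - norm X)"
  using resolvent_op_plus[OF A regular resolvent_le X] by auto

lemma norm_integrand_le:
  assumes t: "t \<in> einterval a b"
  shows "norm (K' (g t) o\<^sub>L R X (g t)) \<le> 1 / (d - norm X) * norm (K' (g t))"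
  using norm_blinfun_compose[of "K' (g t)" "R X (g t)"]
    mult_left_mono[OF resolvent_op_plus_le[OF t] norm_ge_zero[of "K' (g t)"]]
  by (simp add: mult.commute)

lemma integrand_integrable: "\<exists>I. has_line_integral (\<lambda>z. K' z o\<^sub>L R X z) I a b g"
proof (rule line_integral_exists)
  have "continuous_on (g ` einterval a b) (R X)"
    using regular_op_plus resolvent_op_plus_le by (intro continuous_on_resolvent) auto
  then have "continuous_on (einterval a b) (\<lambda>t. R X (g t))"
    using cont_g by (rule continuous_on_compose2) auto
  with cont_K show "continuous_on (einterval a b) (\<lambda>t. K' (g t) o\<^sub>L R X (g t))"
    by (rule bounded_bilinear.continuous_on[OF bounded_bilinear_blinfun_compose])
  show "0 \<le> 1 / (d - norm X)" using X by simp
qed (rule norm_integrand_le)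

lemma W1_defined_op_plus: "W1_defined K' (op_plus A X) a b g"
  unfolding W1_defined_def
  using regular_op_plus resolvent_op_plus_le integrand_integrable
  by (auto simp: bounded_iff)

lemma has_line_integral_W1: "has_line_integral (\<lambda>z. K' z o\<^sub>L R X z) (- F X) a b g"
proof -
  obtain I where I: "has_line_integral (\<lambda>z. K' z o\<^sub>L R X z) I a b g"
    using integrand_integrable by blast
  then have "(THE I. has_line_integral (\<lambda>z. K' z o\<^sub>L R X z) I a b g) = I"
    by (rule the_equality) (rule has_line_integral_unique[OF _ I])
  with I show ?thesis by (simp add: W1_def)
qed

lemma norm_W1_le: "norm (F X) \<le> v / (d - norm X)"
  using has_line_integral_norm_le[OF has_line_integral_W1 norm_integrand_le] by simp

lemma W1_in_bounded_ops: "F X \<in> bounded_ops"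
proof -
  have "- F X \<in> bounded_ops"
  proof (rule has_cell_integral_in_closed_subspace[OF a_less_b
        has_line_integral_W1[unfolded has_line_integral_def] closed_bounded_ops subspace_bounded_ops])
    fix t x y assume "{x..y} \<subseteq> einterval a b" "t \<in> {x..y}"
    then have t: "t \<in> einterval a b" by blast
    show "(g (Sup {x..y}) - g (Inf {x..y})) *\<^sub>C (K' (g t) o\<^sub>L R X (g t)) \<in> bounded_ops"
      using is_resolventD(1)[OF is_resolvent_resolvent[OF regular_op_plus[OF t]]] ops[OF t]
      by (intro bounded_ops_scaleC bounded_ops_compose)
  qed
  from subspace_neg[OF subspace_bounded_ops this] show ?thesis by simp
qed

end

lemma norm_W1_diff_le:
  assumes X: "X \<in> bounded_ops" "norm X \<le> r" and Y: "Y \<in> bounded_ops" "norm Y \<le> r" and "r < d"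
  shows "norm (F X - F Y) \<le> v / (d - r)\<^sup>2 * norm (X - Y)"
proof -
  have Xd: "norm X < d" "norm Y < d" using assms by auto
  let ?M = "norm (X - Y) / (d - r)\<^sup>2"
  have "norm ((- F X) - (- F Y)) \<le> ?M * v"
  proof (rule has_line_integral_norm_le)
    show "has_line_integral (\<lambda>z. (K' z o\<^sub>L R X z) - (K' z o\<^sub>L R Y z)) ((- F X) - (- F Y)) a b g"
      using X Y Xd by (intro has_line_integral_diff has_line_integral_W1)
    fix t assume t: "t \<in> einterval a b"
    have le: "norm (R Z (g t)) \<le> 1 / (d - r)" if "Z \<in> bounded_ops" "norm Z \<le> r" for Z
    proof -
      have "norm (R Z (g t)) \<le> 1 / (d - norm Z)"
        using that \<open>r < d\<close> by (intro resolvent_op_plus_le t) auto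
      also have "\<dots> \<le> 1 / (d - r)" using that \<open>r < d\<close> by (intro divide_left_mono) auto
      finally show ?thesis .
    qed
    have "norm (R X (g t) - R Y (g t)) \<le> norm (R X (g t)) * norm (X - Y) * norm (R Y (g t))"
      using X Y Xd t by (intro norm_resolvent_op_plus_diff_le regular_op_plus)
    also have "\<dots> \<le> 1 / (d - r) * norm (X - Y) * (1 / (d - r))"
      using le[OF X] le[OF Y] \<open>r < d\<close> by (intro mult_mono) auto
    also have "\<dots> = ?M" by (simp add: power2_eq_square)
    finally have "norm (K' (g t)) * norm (R X (g t) - R Y (g t)) \<le> norm (K' (g t)) * ?M"
      by (rule mult_left_mono) simp
    moreover have "(K' (g t) o\<^sub>L R X (g t)) - (K' (g t) o\<^sub>L R Y (g t)) =
        K' (g t) o\<^sub>L (R X (g t) - R Y (g t))"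
      by (rule blinfun_eqI) (simp add: blinfun.diff_left blinfun.diff_right)
    ultimately show "norm ((K' (g t) o\<^sub>L R X (g t)) - (K' (g t) o\<^sub>L R Y (g t))) \<le> ?M * norm (K' (g t))"
      using norm_blinfun_compose[of "K' (g t)" "R X (g t) - R Y (g t)"] by (simp add: mult.commute)
  qed
  then show ?thesis by (simp add: norm_minus_commute mult.commute)
qed

text \<open>The ball of radius \<open>r_min\<close> is invariant since \<open>v / (d - r_min) = r_min\<close>, and \<open>F\<close> has a
  Lipschitz constant below \<open>1\<close> on every ball of radius \<open>r < r_max\<close>. Existence comes from the smallest ball, uniqueness from the
  ball of radius \<open>r\<close>.\<close>

theorem basic_equation_solution:
  assumes vd: "v < d\<^sup>2 / 4" and r: "r_min d v \<le> r" "r < r_max d v"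
  shows "(\<exists>!X. X \<in> bounded_ops \<and> norm X \<le> r \<and> solves_basic_equation K' A a b g X) \<and>
    (\<forall>X. X \<in> bounded_ops \<and> norm X \<le> r \<and> solves_basic_equation K' A a b g X \<longrightarrow> norm X \<le> r_min d v)"
proof -
  define s where "s = r_min d v"
  define q where "q = sqrt (d\<^sup>2 / 4 - v)"
  have q: "q > 0" "q\<^sup>2 = d\<^sup>2 / 4 - v" using vd by (simp_all add: q_def)
  have s: "s = d / 2 - q" by (simp add: s_def r_min_def q_def)
  have "q \<le> d / 2"
    by (rule power2_le_imp_le) (use v_nonneg d_pos q(2) in \<open>simp_all add: power_divide\<close>)
  then have "0 \<le> s" by (simp add: s)
  have s_eq: "s * (d - s) = v"
    using q(2) by (simp add: s power2_eq_square algebra_simps)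
  have "sqrt v \<ge> 0" using v_nonneg by simp
  then have "r < d" using r(2) unfolding r_max_def by linarith
  have "s \<le> r" using r(1) by (simp add: s_def)
  have contraction: "0 \<le> v / (d - t)\<^sup>2" "v / (d - t)\<^sup>2 < 1" if "t \<le> r" for t
  proof -
    have "sqrt v < d - t" using r(2) that by (simp add: r_max_def)
    then have "(sqrt v)\<^sup>2 < (d - t)\<^sup>2" using \<open>sqrt v \<ge> 0\<close> by (intro power_strict_mono) auto
    then show "0 \<le> v / (d - t)\<^sup>2" "v / (d - t)\<^sup>2 < 1" using v_nonneg by (simp_all add: divide_less_eq)
  qed
  let ?S = "bounded_ops \<inter> cball (0 :: 'h \<Rightarrow>\<^sub>L 'h) s"
  have "\<exists>!X\<in>?S. F X = X"
  proof (rule Banach_fix)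
    show "complete ?S" by (intro closed_Int closed_bounded_ops closed_cball complete_eq_closed[THEN iffD2])
    show "?S \<noteq> {}" using \<open>0 \<le> s\<close> subspace_0[OF subspace_bounded_ops] by auto
    show "F ` ?S \<subseteq> ?S"
    proof safe
      fix X :: "'h \<Rightarrow>\<^sub>L 'h"
      assume X: "X \<in> bounded_ops" "X \<in> cball 0 s"
      then have "norm X \<le> s" by simp
      then have Xd: "norm X < d" using \<open>s \<le> r\<close> \<open>r < d\<close> by simp
      show "F X \<in> bounded_ops" by (rule W1_in_bounded_ops[OF X(1) Xd])
      have "norm (F X) \<le> v / (d - norm X)" by (rule norm_W1_le[OF X(1) Xd])
      also have "\<dots> \<le> v / (d - s)"
        using v_nonneg \<open>norm X \<le> s\<close> \<open>s \<le> r\<close> \<open>r < d\<close> by (intro divide_left_mono) auto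
      also have "\<dots> = s" using s_eq \<open>s \<le> r\<close> \<open>r < d\<close> by (simp add: field_simps)
      finally show "F X \<in> cball 0 s" by simp
    qed
    show "0 \<le> v / (d - s)\<^sup>2" "v / (d - s)\<^sup>2 < 1" using contraction[OF \<open>s \<le> r\<close>] .
    show "dist (F X) (F Y) \<le> v / (d - s)\<^sup>2 * dist X Y" if "X \<in> ?S" "Y \<in> ?S" for X Y
      using norm_W1_diff_le[of X s Y] that \<open>s \<le> r\<close> \<open>r < d\<close> by (simp add: dist_norm)
  qed
  then obtain X where X: "X \<in> bounded_ops" "norm X \<le> s" "F X = X" by auto
  have "solves_basic_equation K' A a b g X"
    using W1_defined_op_plus[OF X(1)] X \<open>s \<le> r\<close> \<open>r < d\<close> by (simp add: solves_basic_equation_def)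
  moreover have "Y = X"
    if Y: "Y \<in> bounded_ops" "norm Y \<le> r" "solves_basic_equation K' A a b g Y"
    for Y :: "'h \<Rightarrow>\<^sub>L 'h"
  proof -
    have "F Y = Y" using Y(3) by (simp add: solves_basic_equation_def)
    then have "norm (Y - X) \<le> v / (d - r)\<^sup>2 * norm (Y - X)"
      using norm_W1_diff_le[OF Y(1,2) X(1) _ \<open>r < d\<close>] X(2,3) \<open>s \<le> r\<close> by simp
    then have "norm (Y - X) * (1 - v / (d - r)\<^sup>2) \<le> 0" by (simp add: algebra_simps)
    then show "Y = X" using contraction(2)[of r] by (simp add: mult_le_0_iff)
  qed
  moreover have "norm X \<le> r" using X(2) \<open>s \<le> r\<close> by simp
  ultimately show ?thesis using X(1,2) unfolding s_def by blast
qed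

end

section \<open>Contours in the domain of continuation\<close>

text \<open>A contour is the final stage of a continuous deformation.\<close>

lemma contour_continuous:
  assumes "contour_in a b D g"
  shows "continuous_on (einterval a b) g"
proof -
  obtain H where H: "continuous_on ({0..1} \<times> einterval a b) H"
    "\<forall>t\<in>einterval a b. H (0 :: real, t) = complex_of_real t \<and> H (1, t) = g t"
    using assms unfolding contour_in_def by blast
  have "continuous_on (einterval a b) (\<lambda>t. H (1, t))"
    by (rule continuous_on_compose2[OF H(1)]) (auto intro!: continuous_intros)
  then show ?thesis by (rule continuous_on_eq) (use H(2) in auto)
qed

text \<open>On the reflected domain \<open>K' z\<close> is the adjoint of \<open>K' (cnj z)\<close>, so that continuity and complex
  linearity carry over from \<open>D\<close>.\<close>

lemma continuation_on_reflected_domain: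
  assumes "analytic_continuation_of_derivative K a b D K'"
  shows "continuous_on (cnj ` D) K'" and "z \<in> cnj ` D \<Longrightarrow> K' z \<in> bounded_ops"
proof -
  have ops: "\<And>w. w \<in> D \<Longrightarrow> K' w \<in> bounded_ops" and cont: "continuous_on D K'"
    and refl: "\<And>w. w \<in> D \<Longrightarrow> K' (cnj w) = hadjoint (K' w)"
    using assms unfolding analytic_continuation_of_derivative_def
    by (auto intro: continuous_on_subset)
  show "K' z \<in> bounded_ops" if "z \<in> cnj ` D"
    using that hadjoint_in_bounded_ops[OF ops] refl by auto
  have "continuous_on (cnj ` D) (\<lambda>z. hadjoint (K' (cnj z)))"
    by (intro continuous_on_hadjoint continuous_on_compose2[OF cont] continuous_intros)
      (auto intro: ops)
  then show "continuous_on (cnj ` D) K'" by (rule continuous_on_eq) (auto simp: refl)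
qed

theorem theorem3p1:
  fixes A0 :: "'h0::complex_hilbert operator"
    and A1 :: "'h1::complex_hilbert operator"
    and B :: "'h1 \<Rightarrow>\<^sub>L 'h0"
    and E :: "real set \<Rightarrow> 'h0 \<Rightarrow>\<^sub>L 'h0"
    and \<mu>1 \<mu>2 :: ereal
    and D :: "complex set"
    and K' :: "complex \<Rightarrow> 'h1 \<Rightarrow>\<^sub>L 'h1"
    and \<Gamma> :: "real \<Rightarrow> complex"
  assumes "self_adjoint A0" and "self_adjoint A1" and "B \<in> bounded_ops"
    and "spectral_measure A0 E" and "absolutely_continuous_spectrum E"
    and "\<mu>1 < \<mu>2"
    and "spectrum A0 = complex_of_real ` closure (einterval \<mu>1 \<mu>2)"
    and "spectrum A1 \<subseteq> complex_of_real ` einterval \<mu>1 \<mu>2"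
    and "open D" and "connected D" and "simply_connected D" and "D \<subseteq> {z. Im z < 0}"
    and "complex_of_real ` einterval \<mu>1 \<mu>2 \<subseteq> frontier D"
    and "analytic_continuation_of_derivative (K_B B E) \<mu>1 \<mu>2 D K'"
    and "endpoint_growth K' (D \<union> cnj ` D) \<mu>1"
    and "endpoint_growth K' (D \<union> cnj ` D) \<mu>2"
    and "contour_in \<mu>1 \<mu>2 D \<Gamma> \<or> contour_in \<mu>1 \<mu>2 (cnj ` D) \<Gamma>"
    and "admissible K' \<mu>1 \<mu>2 \<Gamma>"
    and "V0 K' \<mu>1 \<mu>2 \<Gamma> < 1 / 4 * (dist_to_spectrum A1 \<mu>1 \<mu>2 \<Gamma>)\<^sup>2"
  shows "\<forall>r. r_min (dist_to_spectrum A1 \<mu>1 \<mu>2 \<Gamma>) (V0 K' \<mu>1 \<mu>2 \<Gamma>) \<le> r \<longrightarrow>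
             r < r_max (dist_to_spectrum A1 \<mu>1 \<mu>2 \<Gamma>) (V0 K' \<mu>1 \<mu>2 \<Gamma>) \<longrightarrow>
    (\<exists>!X. X \<in> bounded_ops \<and> norm X \<le> r \<and> solves_basic_equation K' A1 \<mu>1 \<mu>2 \<Gamma> X) \<and>
    (\<forall>X. X \<in> bounded_ops \<and> norm X \<le> r \<and> solves_basic_equation K' A1 \<mu>1 \<mu>2 \<Gamma> X \<longrightarrow>
         norm X \<le> r_min (dist_to_spectrum A1 \<mu>1 \<mu>2 \<Gamma>) (V0 K' \<mu>1 \<mu>2 \<Gamma>))"
proof (intro allI impI)
  let ?v = "V0 K' \<mu>1 \<mu>2 \<Gamma>" and ?d = "dist_to_spectrum A1 \<mu>1 \<mu>2 \<Gamma>"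
  let ?I = "einterval \<mu>1 \<mu>2"
  note sa = assms(2) and ab = assms(6) and cont = assms(14)
  fix r assume r: "r_min ?d ?v \<le> r" "r < r_max ?d ?v"
  obtain D' where contour: "contour_in \<mu>1 \<mu>2 D' \<Gamma>"
    and cont': "continuous_on D' K'" and ops': "\<And>z. z \<in> D' \<Longrightarrow> K' z \<in> bounded_ops"
    using assms(17)
  proof
    assume "contour_in \<mu>1 \<mu>2 D \<Gamma>"
    moreover have "continuous_on D K'" "\<And>z. z \<in> D \<Longrightarrow> K' z \<in> bounded_ops"
      using cont unfolding analytic_continuation_of_derivative_def
      by (auto intro: continuous_on_subset)
    ultimately show ?thesis using that by blast
  next
    assume "contour_in \<mu>1 \<mu>2 (cnj ` D) \<Gamma>"
    with continuation_on_reflected_domain[OF cont] that show ?thesis by blast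
  qed
  have in_D': "\<Gamma> ` ?I \<subseteq> D'"
    and rect: "curve_length \<Gamma> (?I \<inter> {x..y}) < \<infinity>" for x y
    using contour unfolding contour_in_def by auto
  note cont_\<Gamma> = contour_continuous[OF contour]
  obtain v where v: "has_arclength_integral (\<lambda>z. norm (K' z)) v \<mu>1 \<mu>2 \<Gamma>"
    using assms(18) unfolding admissible_def by blast
  have "?v = v" unfolding V0_def
    using v has_cell_integral_unique[OF ab]
    by (intro the_equality) (auto simp: has_arclength_integral_def)
  with v have V0: "has_arclength_integral (\<lambda>z. norm (K' z)) ?v \<mu>1 \<mu>2 \<Gamma>" by simp
  have "0 \<le> ?v"
    using has_arclength_integral_nonneg[OF ab V0] by simp
  then have "0 < ?d\<^sup>2" using assms(19) by linarith
  then have "0 < ?d" using setdist_pos_le[of "spectrum A1" "\<Gamma> ` ?I"]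
    by (simp add: dist_to_spectrum_def order_less_le)
  have gap: "?d \<le> cmod (l - \<Gamma> t)" if "l \<in> spectrum A1" "t \<in> ?I" for l t
    unfolding dist_to_spectrum_def dist_norm[symmetric] using that by (intro setdist_le_dist) auto
  note res = self_adjoint_resolvent_bound[OF sa \<open>0 < ?d\<close> gap]
  interpret contour_near_operator K' A1 \<mu>1 \<mu>2 \<Gamma> ?v ?d
  proof
    show "continuous_on ?I (\<lambda>t. K' (\<Gamma> t))"
      by (rule continuous_on_compose2[OF cont' cont_\<Gamma> in_D'])
    show "linear_operator A1" using sa by (simp add: self_adjoint_def)
  qed (use ab V0 \<open>0 < ?d\<close> res in_D' ops' rect cont_\<Gamma> in auto)
  show "(\<exists>!X. X \<in> bounded_ops \<and> norm X \<le> r \<and> solves_basic_equation K' A1 \<mu>1 \<mu>2 \<Gamma> X) \<and>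
    (\<forall>X. X \<in> bounded_ops \<and> norm X \<le> r \<and> solves_basic_equation K' A1 \<mu>1 \<mu>2 \<Gamma> X \<longrightarrow>
         norm X \<le> r_min ?d ?v)"
    using assms(19) r by (intro basic_equation_solution) auto
qed

end
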